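(* Let $p\colon\mathcal{E}\to\mathcal{C}$ be a normal bifibration satisfying the Beck--Chevalley condition at every pullback square, and let $\mathbb{D}=(D_1\rightrightarrows D_0)$ be an internal category in $\mathcal{C}$ with source and target maps $s,t\colon D_1\to D_0$. The functor $$\mathcal{T}^p_{\mathbb{D}}\colon p^{-1}(D_0)\longrightarrow p^{-1}(D_0),\qquad \gamma\longmapsto t_!(s^\ast(\gamma)),$$ extends to a monad $\mathcal{T}^p_{\mathbb{D}}=(\mathcal{T}^p_{\mathbb{D}},\eta^{\mathbb{D}},\mu^{\mathbb{D}})$.
   Context: $\mathcal{C}$ is a category with finite limits. An internal category $\mathbb{D}$ in $\mathcal{C}$ consists of objects $D_0,D_1$, source and target maps $s,t\colon D_1\to D_0$, an identity map $i\colon D_0\to D_1$ and a composition map $\mathrm{comp}\colon D_1\times_{s,D_0,t}D_1\to D_1$, satisfying the usual axioms. For a bifibration $p\colon\mathcal{E}\to\mathcal{C}$ (with chosen cartesian and cocartesian liftings; normal means both the fibration and opfibration structures are normal, i.e. chosen liftings of identities are identities), $p^{-1}(X)$ denotes the fibre over $X$; for $f\colon X\to Y$ in $\mathcal{C}$, $f^\ast\colon p^{-1}(Y)\to p^{-1}(X)$ is the change-of-base functor and $f_!\colon p^{-1}(X)\to p^{-1}(Y)$ is the direct image functor, with $f_!\dashv f^\ast$. Beck--Chevalley condition at every pullback square: for every pullback square in $\mathcal{C}$ with $k\colon W\to X$, $h\colon W\to Y$, $f\colon X\to Z$, $g\colon Y\to Z$, $fk=gh$, the natural transformation $h_!k^\ast\Rightarrow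 g^\ast f_!$, namely the mate of the canonical isomorphism $k^\ast f^\ast\cong h^\ast g^\ast$ under the adjunctions $f_!\dashv f^\ast$ and $h_!\dashv h^\ast$, i.e. the composite $h_!k^\ast\Rightarrow h_!k^\ast f^\ast f_!\cong h_!h^\ast g^\ast f_!\Rightarrow g^\ast f_!$ of the unit, the canonical isomorphism and the counit, is an isomorphism. *)

theory Defs
  imports Main
begin

section \<open>Categories, functors, natural transformations, monads\<close>

record ('o, 'a) cat =
  Obj :: "'o set"
  Arr :: "'a set"
  Dom :: "'a \<Rightarrow> 'o"
  Cod :: "'a \<Rightarrow> 'o"
  Ide :: "'o \<Rightarrow> 'a"
  Comp :: "'a \<Rightarrow> 'a \<Rightarrow> 'a"  (infixr "\<cdot>\<index>" 70)

text \<open>Composition is written in the usual order: \<open>g \<cdot> f\<close> is first \<open>f\<close>, then \<open>g\<close>.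
  All operations are only meaningful on the carriers and on composable arrows.\<close>

definition hom :: "('o, 'a, 'm) cat_scheme \<Rightarrow> 'o \<Rightarrow> 'o \<Rightarrow> 'a set" where
  "hom C X Y = {f \<in> Arr C. Dom C f = X \<and> Cod C f = Y}"

locale category =
  fixes C :: "('o, 'a, 'm) cat_scheme" (structure)
  assumes Dom_Obj: "f \<in> Arr C \<Longrightarrow> Dom C f \<in> Obj C"
    and Cod_Obj: "f \<in> Arr C \<Longrightarrow> Cod C f \<in> Obj C"
    and Ide_hom: "X \<in> Obj C \<Longrightarrow> Ide C X \<in> hom C X X"
    and Comp_hom: "f \<in> hom C X Y \<Longrightarrow> g \<in> hom C Y Z \<Longrightarrow> g \<cdot> f \<in> hom C X Z"
    and Comp_Ide_left: "f \<in> hom C X Y \<Longrightarrow> Ide C Y \<cdot> f = f"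
    and Comp_Ide_right: "f \<in> hom C X Y \<Longrightarrow> f \<cdot> Ide C X = f"
    and Comp_assoc:
      "f \<in> hom C W X \<Longrightarrow> g \<in> hom C X Y \<Longrightarrow> h \<in> hom C Y Z \<Longrightarrow> (h \<cdot> g) \<cdot> f = h \<cdot> (g \<cdot> f)"

definition iso :: "('o, 'a, 'm) cat_scheme \<Rightarrow> 'a \<Rightarrow> bool" where
  "iso C f \<longleftrightarrow> f \<in> Arr C \<and>
     (\<exists>g \<in> hom C (Cod C f) (Dom C f).
        g \<cdot>\<^bsub>C\<^esub> f = Ide C (Dom C f) \<and> f \<cdot>\<^bsub>C\<^esub> g = Ide C (Cod C f))"

record ('o, 'a, 'p, 'b) fctr =
  fobj :: "'o \<Rightarrow> 'p"
  farr :: "'a \<Rightarrow> 'b"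

locale is_functor = A: category A + B: category B
  for A :: "('o, 'a, 'm) cat_scheme" and B :: "('p, 'b, 'n) cat_scheme" +
  fixes F :: "('o, 'a, 'p, 'b) fctr"
  assumes fobj_Obj: "X \<in> Obj A \<Longrightarrow> fobj F X \<in> Obj B"
    and farr_hom: "f \<in> hom A X Y \<Longrightarrow> farr F f \<in> hom B (fobj F X) (fobj F Y)"
    and farr_Ide: "X \<in> Obj A \<Longrightarrow> farr F (Ide A X) = Ide B (fobj F X)"
    and farr_Comp: "f \<in> hom A X Y \<Longrightarrow> g \<in> hom A Y Z \<Longrightarrow>
        farr F (g \<cdot>\<^bsub>A\<^esub> f) = farr F g \<cdot>\<^bsub>B\<^esub> farr F f"

definition id_fctr :: "('o, 'a, 'o, 'a) fctr" where
  "id_fctr = \<lparr>fobj = (\<lambda>X. X), farr = (\<lambda>f. f)\<rparr>"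

definition comp_fctr ::
    "('p, 'b, 'q, 'c) fctr \<Rightarrow> ('o, 'a, 'p, 'b) fctr \<Rightarrow> ('o, 'a, 'q, 'c) fctr"  (infixr "\<circ>\<^sub>F" 60) where
  "G \<circ>\<^sub>F F = \<lparr>fobj = (\<lambda>X. fobj G (fobj F X)), farr = (\<lambda>f. farr G (farr F f))\<rparr>"

locale natural_transformation = F: is_functor A B F + G: is_functor A B G
  for A :: "('o, 'a, 'm) cat_scheme" and B :: "('p, 'b, 'n) cat_scheme"
    and F G :: "('o, 'a, 'p, 'b) fctr" +
  fixes \<tau> :: "'o \<Rightarrow> 'b"
  assumes component_hom: "X \<in> Obj A \<Longrightarrow> \<tau> X \<in> hom B (fobj F X) (fobj G X)"
    and naturality: "f \<in> hom A X Y \<Longrightarrow> \<tau> Y \<cdot>\<^bsub>B\<^esub> farr F f = farr G f \<cdot>\<^bsub>B\<^esub> \<tau> X"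

locale natural_isomorphism = natural_transformation +
  assumes component_iso: "X \<in> Obj A \<Longrightarrow> iso B (\<tau> X)"

locale monad = category A
  + unit: natural_transformation A A id_fctr T \<eta>
  + mult: natural_transformation A A "T \<circ>\<^sub>F T" T \<mu>
  for A :: "('o, 'a, 'm) cat_scheme" (structure)
    and T :: "('o, 'a, 'o, 'a) fctr" and \<eta> \<mu> :: "'o \<Rightarrow> 'a" +
  assumes mult_assoc: "X \<in> Obj A \<Longrightarrow> \<mu> X \<cdot> farr T (\<mu> X) = \<mu> X \<cdot> \<mu> (fobj T X)"
    and unit_left: "X \<in> Obj A \<Longrightarrow> \<mu> X \<cdot> \<eta> (fobj T X) = Ide A (fobj T X)"
    and unit_right: "X \<in> Obj A \<Longrightarrow> \<mu> X \<cdot> farr T (\<eta> X) = Ide A (fobj T X)"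


section \<open>Finite limits and pullbacks\<close>

definition is_cone ::
    "('j, 'k) cat \<Rightarrow> ('o, 'a, 'm) cat_scheme \<Rightarrow> ('j, 'k, 'o, 'a) fctr \<Rightarrow> 'o \<Rightarrow> ('j \<Rightarrow> 'a) \<Rightarrow> bool" where
  "is_cone J C F L \<pi> \<longleftrightarrow> L \<in> Obj C
     \<and> (\<forall>j \<in> Obj J. \<pi> j \<in> hom C L (fobj F j))
     \<and> (\<forall>u \<in> Arr J. farr F u \<cdot>\<^bsub>C\<^esub> \<pi> (Dom J u) = \<pi> (Cod J u))"

definition is_limit ::
    "('j, 'k) cat \<Rightarrow> ('o, 'a, 'm) cat_scheme \<Rightarrow> ('j, 'k, 'o, 'a) fctr \<Rightarrow> 'o \<Rightarrow> ('j \<Rightarrow> 'a) \<Rightarrow> bool" where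
  "is_limit J C F L \<pi> \<longleftrightarrow> is_cone J C F L \<pi>
     \<and> (\<forall>N \<nu>. is_cone J C F N \<nu> \<longrightarrow>
          (\<exists>!u. u \<in> hom C N L \<and> (\<forall>j \<in> Obj J. \<pi> j \<cdot>\<^bsub>C\<^esub> u = \<nu> j)))"

text \<open>Every finite category is isomorphic to one whose objects and arrows are natural numbers,
  so it suffices to let the index category range over those.\<close>

definition has_finite_limits :: "('o, 'a, 'm) cat_scheme \<Rightarrow> bool" where
  "has_finite_limits C \<longleftrightarrow>
     (\<forall>(J :: (nat, nat) cat) F. finite (Obj J) \<longrightarrow> finite (Arr J) \<longrightarrow> is_functor J C F \<longrightarrow>
        (\<exists>L \<pi>. is_limit J C F L \<pi>))"

text \<open>\<open>is_pullback C k h f g\<close>: with \<open>k : W \<rightarrow> X\<close>, \<open>h : W \<rightarrow> Y\<close>, \<open>f : X \<rightarrow> Z\<close>, \<open>g : Y \<rightarrow> Z\<close>,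
  the square \<open>f \<cdot> k = g \<cdot> h\<close> is a pullback.\<close>

definition is_pullback ::
    "('o, 'a, 'm) cat_scheme \<Rightarrow> 'a \<Rightarrow> 'a \<Rightarrow> 'a \<Rightarrow> 'a \<Rightarrow> bool" where
  "is_pullback C k h f g \<longleftrightarrow>
     k \<in> Arr C \<and> h \<in> Arr C \<and> f \<in> Arr C \<and> g \<in> Arr C
     \<and> Dom C k = Dom C h \<and> Cod C k = Dom C f \<and> Cod C h = Dom C g \<and> Cod C f = Cod C g
     \<and> f \<cdot>\<^bsub>C\<^esub> k = g \<cdot>\<^bsub>C\<^esub> h
     \<and> (\<forall>V. \<forall>a \<in> hom C V (Dom C f). \<forall>b \<in> hom C V (Dom C g). f \<cdot>\<^bsub>C\<^esub> a = g \<cdot>\<^bsub>C\<^esub> b \<longrightarrow>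
          (\<exists>!u. u \<in> hom C V (Dom C k) \<and> k \<cdot>\<^bsub>C\<^esub> u = a \<and> h \<cdot>\<^bsub>C\<^esub> u = b))"


section \<open>Internal categories\<close>

text \<open>The chosen fibre product \<open>D\<^sub>1 \<times> D\<^sub>1\<close> over \<open>s\<close>, \<open>t\<close> is part of the data, given by its two
  projections. Its generalised elements are the pairs \<open>(g, f)\<close> with \<open>s g = t f\<close>; the
  composition sends such a pair to ``\<open>g\<close> after \<open>f\<close>''.\<close>

record ('o, 'a) internal_cat =
  ob0 :: 'o
  ob1 :: 'o
  isrc :: 'a
  itgt :: 'a
  iid :: 'a
  ipr1 :: 'a
  ipr2 :: 'a
  icomp :: 'a

text \<open>In \<open>internal_assoc\<close> the maps \<open>q1\<close>, \<open>q2\<close> exhibit any object of composable triples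
  \<open>(h, g, f)\<close>, with \<open>q1 = (h, g)\<close> and \<open>q2 = (g, f)\<close>; then \<open>u\<close> is
  \<open>comp \<times> id\<close> and \<open>v\<close> is \<open>id \<times> comp\<close>. Likewise \<open>u\<close> is \<open>(i t, id)\<close> in \<open>internal_unit_left\<close>
  and \<open>(id, i s)\<close> in \<open>internal_unit_right\<close>. These maps exist and are unique by the universal
  property of the fibre product.\<close>

locale internal_category = category C
  for C :: "('o, 'a, 'm) cat_scheme" (structure) +
  fixes D :: "('o, 'a) internal_cat"
  assumes ob0_Obj: "ob0 D \<in> Obj C"
    and ob1_Obj: "ob1 D \<in> Obj C"
    and isrc_hom: "isrc D \<in> hom C (ob1 D) (ob0 D)"
    and itgt_hom: "itgt D \<in> hom C (ob1 D) (ob0 D)"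
    and iid_hom: "iid D \<in> hom C (ob0 D) (ob1 D)"
    and pairs_pullback: "is_pullback C (ipr1 D) (ipr2 D) (isrc D) (itgt D)"
    and icomp_hom: "icomp D \<in> hom C (Dom C (ipr1 D)) (ob1 D)"
    and isrc_iid: "isrc D \<cdot> iid D = Ide C (ob0 D)"
    and itgt_iid: "itgt D \<cdot> iid D = Ide C (ob0 D)"
    and isrc_icomp: "isrc D \<cdot> icomp D = isrc D \<cdot> ipr2 D"
    and itgt_icomp: "itgt D \<cdot> icomp D = itgt D \<cdot> ipr1 D"
    and internal_unit_left:
      "u \<in> hom C (ob1 D) (Dom C (ipr1 D)) \<Longrightarrow>
       ipr1 D \<cdot> u = iid D \<cdot> itgt D \<Longrightarrow> ipr2 D \<cdot> u = Ide C (ob1 D) \<Longrightarrow>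
       icomp D \<cdot> u = Ide C (ob1 D)"
    and internal_unit_right:
      "u \<in> hom C (ob1 D) (Dom C (ipr1 D)) \<Longrightarrow>
       ipr1 D \<cdot> u = Ide C (ob1 D) \<Longrightarrow> ipr2 D \<cdot> u = iid D \<cdot> isrc D \<Longrightarrow>
       icomp D \<cdot> u = Ide C (ob1 D)"
    and internal_assoc:
      "is_pullback C q1 q2 (ipr2 D) (ipr1 D) \<Longrightarrow>
       u \<in> hom C (Dom C q1) (Dom C (ipr1 D)) \<Longrightarrow>
       ipr1 D \<cdot> u = icomp D \<cdot> q1 \<Longrightarrow> ipr2 D \<cdot> u = ipr2 D \<cdot> q2 \<Longrightarrow>
       v \<in> hom C (Dom C q1) (Dom C (ipr1 D)) \<Longrightarrow>
       ipr1 D \<cdot> v = ipr1 D \<cdot> q1 \<Longrightarrow> ipr2 D \<cdot> v = icomp D \<cdot> q2 \<Longrightarrow>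
       icomp D \<cdot> u = icomp D \<cdot> v"


section \<open>Bifibrations\<close>

text \<open>The type parameters \<open>'o\<close>, \<open>'a\<close> belong to the base and \<open>'p\<close>, \<open>'b\<close> to the total category.
  \<open>cart P f \<gamma>\<close> is the chosen cartesian lifting of \<open>f : X \<rightarrow> Y\<close> with codomain \<open>\<gamma>\<close> over \<open>Y\<close>, and
  \<open>cocart P f \<gamma>\<close> is the chosen cocartesian lifting of \<open>f\<close> with domain \<open>\<gamma>\<close> over \<open>X\<close>.\<close>

record ('o, 'a, 'p, 'b) bifib =
  base :: "('o, 'a) cat"
  total :: "('p, 'b) cat"
  proj :: "('p, 'b, 'o, 'a) fctr"
  cart :: "'a \<Rightarrow> 'p \<Rightarrow> 'b"
  cocart :: "'a \<Rightarrow> 'p \<Rightarrow> 'b"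

definition is_cartesian :: "('o, 'a, 'p, 'b) bifib \<Rightarrow> 'b \<Rightarrow> bool" where
  "is_cartesian P \<phi> \<longleftrightarrow> \<phi> \<in> Arr (total P) \<and>
     (\<forall>\<delta> \<in> Obj (total P). \<forall>\<psi> \<in> hom (total P) \<delta> (Cod (total P) \<phi>).
      \<forall>w \<in> hom (base P) (fobj (proj P) \<delta>) (fobj (proj P) (Dom (total P) \<phi>)).
        farr (proj P) \<psi> = farr (proj P) \<phi> \<cdot>\<^bsub>base P\<^esub> w \<longrightarrow>
        (\<exists>!\<chi>. \<chi> \<in> hom (total P) \<delta> (Dom (total P) \<phi>)
              \<and> farr (proj P) \<chi> = w \<and> \<phi> \<cdot>\<^bsub>total P\<^esub> \<chi> = \<psi>))"

definition is_cocartesian :: "('o, 'a, 'p, 'b) bifib \<Rightarrow> 'b \<Rightarrow> bool" where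
  "is_cocartesian P \<phi> \<longleftrightarrow> \<phi> \<in> Arr (total P) \<and>
     (\<forall>\<delta> \<in> Obj (total P). \<forall>\<psi> \<in> hom (total P) (Dom (total P) \<phi>) \<delta>.
      \<forall>w \<in> hom (base P) (fobj (proj P) (Cod (total P) \<phi>)) (fobj (proj P) \<delta>).
        farr (proj P) \<psi> = w \<cdot>\<^bsub>base P\<^esub> farr (proj P) \<phi> \<longrightarrow>
        (\<exists>!\<chi>. \<chi> \<in> hom (total P) (Cod (total P) \<phi>) \<delta>
              \<and> farr (proj P) \<chi> = w \<and> \<chi> \<cdot>\<^bsub>total P\<^esub> \<phi> = \<psi>))"

definition fibre :: "('o, 'a, 'p, 'b) bifib \<Rightarrow> 'o \<Rightarrow> ('p, 'b) cat" where
  "fibre P X = (total P)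
     \<lparr>Obj := {\<gamma> \<in> Obj (total P). fobj (proj P) \<gamma> = X},
      Arr := {\<phi> \<in> Arr (total P). farr (proj P) \<phi> = Ide (base P) X}\<rparr>"

locale bifibration = is_functor "total P" "base P" "proj P"
  for P :: "('o, 'a, 'p, 'b) bifib" +
  assumes cart_lift:
      "f \<in> hom (base P) X Y \<Longrightarrow> \<gamma> \<in> Obj (fibre P Y) \<Longrightarrow>
       is_cartesian P (cart P f \<gamma>) \<and> Cod (total P) (cart P f \<gamma>) = \<gamma>
       \<and> farr (proj P) (cart P f \<gamma>) = f"
    and cocart_lift:
      "f \<in> hom (base P) X Y \<Longrightarrow> \<gamma> \<in> Obj (fibre P X) \<Longrightarrow>
       is_cocartesian P (cocart P f \<gamma>) \<and> Dom (total P) (cocart P f \<gamma>) = \<gamma>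
       \<and> farr (proj P) (cocart P f \<gamma>) = f"

locale normal_bifibration = bifibration +
  assumes cart_Ide:
      "X \<in> Obj (base P) \<Longrightarrow> \<gamma> \<in> Obj (fibre P X) \<Longrightarrow> cart P (Ide (base P) X) \<gamma> = Ide (total P) \<gamma>"
    and cocart_Ide:
      "X \<in> Obj (base P) \<Longrightarrow> \<gamma> \<in> Obj (fibre P X) \<Longrightarrow> cocart P (Ide (base P) X) \<gamma> = Ide (total P) \<gamma>"

text \<open>Change of base \<open>f\<^sup>*\<close>; on arrows it is determined by
  \<open>cart f \<gamma>' \<cdot> f\<^sup>* \<phi> = \<phi> \<cdot> cart f \<gamma>\<close> for \<open>\<phi> : \<gamma> \<rightarrow> \<gamma>'\<close>.\<close>

definition pull :: "('o, 'a, 'p, 'b) bifib \<Rightarrow> 'a \<Rightarrow> ('p, 'b, 'p, 'b) fctr" where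
  "pull P f =
     \<lparr>fobj = (\<lambda>\<gamma>. Dom (total P) (cart P f \<gamma>)),
      farr = (\<lambda>\<phi>. let \<gamma> = Dom (total P) \<phi>; \<gamma>' = Cod (total P) \<phi> in
        (THE \<chi>. \<chi> \<in> hom (fibre P (Dom (base P) f))
                       (Dom (total P) (cart P f \<gamma>)) (Dom (total P) (cart P f \<gamma>'))
             \<and> cart P f \<gamma>' \<cdot>\<^bsub>total P\<^esub> \<chi> = \<phi> \<cdot>\<^bsub>total P\<^esub> cart P f \<gamma>))\<rparr>"

text \<open>Direct image \<open>f\<^sub>!\<close>; on arrows it is determined by
  \<open>f\<^sub>! \<phi> \<cdot> cocart f \<gamma> = cocart f \<gamma>' \<cdot> \<phi>\<close> for \<open>\<phi> : \<gamma> \<rightarrow> \<gamma>'\<close>.\<close>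

definition push :: "('o, 'a, 'p, 'b) bifib \<Rightarrow> 'a \<Rightarrow> ('p, 'b, 'p, 'b) fctr" where
  "push P f =
     \<lparr>fobj = (\<lambda>\<gamma>. Cod (total P) (cocart P f \<gamma>)),
      farr = (\<lambda>\<phi>. let \<gamma> = Dom (total P) \<phi>; \<gamma>' = Cod (total P) \<phi> in
        (THE \<chi>. \<chi> \<in> hom (fibre P (Cod (base P) f))
                       (Cod (total P) (cocart P f \<gamma>)) (Cod (total P) (cocart P f \<gamma>'))
             \<and> \<chi> \<cdot>\<^bsub>total P\<^esub> cocart P f \<gamma> = cocart P f \<gamma>' \<cdot>\<^bsub>total P\<^esub> \<phi>))\<rparr>"

text \<open>Unit \<open>\<gamma> \<rightarrow> f\<^sup>* f\<^sub>! \<gamma>\<close> and counit \<open>f\<^sub>! f\<^sup>* \<gamma> \<rightarrow> \<gamma>\<close> of the adjunction \<open>f\<^sub>! \<stileturn> f\<^sup>*\<close>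
  induced by the chosen liftings: both correspond to vertical factorisations of one chosen
  lifting through the other.\<close>

definition adj_unit :: "('o, 'a, 'p, 'b) bifib \<Rightarrow> 'a \<Rightarrow> 'p \<Rightarrow> 'b" where
  "adj_unit P f \<gamma> =
     (THE \<chi>. \<chi> \<in> hom (fibre P (Dom (base P) f)) \<gamma> (fobj (pull P f) (fobj (push P f) \<gamma>))
          \<and> cart P f (fobj (push P f) \<gamma>) \<cdot>\<^bsub>total P\<^esub> \<chi> = cocart P f \<gamma>)"

definition adj_counit :: "('o, 'a, 'p, 'b) bifib \<Rightarrow> 'a \<Rightarrow> 'p \<Rightarrow> 'b" where
  "adj_counit P f \<gamma> =
     (THE \<chi>. \<chi> \<in> hom (fibre P (Cod (base P) f)) (fobj (push P f) (fobj (pull P f) \<gamma>)) \<gamma>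
          \<and> \<chi> \<cdot>\<^bsub>total P\<^esub> cocart P f (fobj (pull P f) \<gamma>) = cart P f \<gamma>)"

text \<open>For \<open>f \<cdot> k = g \<cdot> h\<close>, both \<open>cart f \<gamma> \<cdot> cart k (f\<^sup>* \<gamma>)\<close> and \<open>cart g \<gamma> \<cdot> cart h (g\<^sup>* \<gamma>)\<close> are
  cartesian liftings of this composite; comparing them gives the canonical isomorphism
  \<open>k\<^sup>* f\<^sup>* \<gamma> \<rightarrow> h\<^sup>* g\<^sup>* \<gamma>\<close>.\<close>

definition pull_comparison ::
    "('o, 'a, 'p, 'b) bifib \<Rightarrow> 'a \<Rightarrow> 'a \<Rightarrow> 'a \<Rightarrow> 'a \<Rightarrow> 'p \<Rightarrow> 'b" where
  "pull_comparison P k h f g \<gamma> =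
     (THE \<chi>. \<chi> \<in> hom (fibre P (Dom (base P) k))
                    (fobj (pull P k) (fobj (pull P f) \<gamma>)) (fobj (pull P h) (fobj (pull P g) \<gamma>))
          \<and> (cart P g \<gamma> \<cdot>\<^bsub>total P\<^esub> cart P h (fobj (pull P g) \<gamma>)) \<cdot>\<^bsub>total P\<^esub> \<chi>
            = cart P f \<gamma> \<cdot>\<^bsub>total P\<^esub> cart P k (fobj (pull P f) \<gamma>))"

text \<open>The mate
  \<open>h\<^sub>! k\<^sup>* \<gamma> \<rightarrow> h\<^sub>! k\<^sup>* f\<^sup>* f\<^sub>! \<gamma> \<rightarrow> h\<^sub>! h\<^sup>* g\<^sup>* f\<^sub>! \<gamma> \<rightarrow> g\<^sup>* f\<^sub>! \<gamma>\<close>.\<close>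

definition mate :: "('o, 'a, 'p, 'b) bifib \<Rightarrow> 'a \<Rightarrow> 'a \<Rightarrow> 'a \<Rightarrow> 'a \<Rightarrow> 'p \<Rightarrow> 'b" where
  "mate P k h f g \<gamma> =
     adj_counit P h (fobj (pull P g) (fobj (push P f) \<gamma>))
     \<cdot>\<^bsub>total P\<^esub> farr (push P h) (pull_comparison P k h f g (fobj (push P f) \<gamma>))
     \<cdot>\<^bsub>total P\<^esub> farr (push P h) (farr (pull P k) (adj_unit P f \<gamma>))"

definition beck_chevalley :: "('o, 'a, 'p, 'b) bifib \<Rightarrow> bool" where
  "beck_chevalley P \<longleftrightarrow>
     (\<forall>k h f g. is_pullback (base P) k h f g \<longrightarrow>
        natural_isomorphism (fibre P (Dom (base P) f)) (fibre P (Dom (base P) g))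
          (push P h \<circ>\<^sub>F pull P k) (pull P g \<circ>\<^sub>F push P f) (mate P k h f g))"

definition internal_fctr ::
    "('o, 'a, 'p, 'b) bifib \<Rightarrow> ('o, 'a) internal_cat \<Rightarrow> ('p, 'b, 'p, 'b) fctr" where
  "internal_fctr P D = push P (itgt D) \<circ>\<^sub>F pull P (isrc D)"

end

theory Submission
  imports Defs
begin

text \<open>A generalised arrow \<open>u : V \<rightarrow> D\<^sub>1\<close> of the internal category turns an arrow \<open>\<psi> : \<xi> \<rightarrow> \<gamma>\<close> over \<open>s u\<close> into
  an arrow \<open>act u \<psi> : \<xi> \<rightarrow> T \<gamma>\<close> over \<open>t u\<close>: factor \<open>\<psi>\<close> through the cartesian arrow \<open>s\<^sup>* \<gamma> \<rightarrow> \<gamma>\<close> by an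
  arrow over \<open>u\<close>, then compose with the cocartesian arrow \<open>s\<^sup>* \<gamma> \<rightarrow> t\<^sub>! s\<^sup>* \<gamma> = T \<gamma>\<close>. This operation is
  natural in \<open>V\<close>, \<open>\<xi>\<close> and \<open>\<gamma>\<close>, and all structure of the monad is expressed through it:
  the unit is \<open>\<eta> \<gamma> = act i id\<close>, and the multiplication is the vertical arrow with
  \<open>\<mu> \<gamma> \<bullet> act u (act v \<psi>) = act (u \<circ> v) \<psi>\<close> whenever \<open>s u = t v\<close> (lemma \<open>mu_act\<close>), where \<open>u \<circ> v\<close> is
  the composite in \<open>D\<close>. Given these descriptions, the monad laws become the unit and associativity
  laws of \<open>D\<close>, applied to generalised arrows.

  What needs an argument is that \<open>\<mu>\<close> exists and that vertical arrows out of \<open>T T \<gamma>\<close> and \<open>T T T \<gamma>\<close> are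
  determined by their composites with iterated \<open>act\<close>. Both follow once the universal
  instance of \<open>act u (act v \<psi>)\<close>, in which \<open>u\<close>, \<open>v\<close> are the projections of the object of composable pairs
  and \<open>\<psi>\<close> is cartesian, is known to be cocartesian (\<open>pair_cocart\<close>), and likewise for composable
  triples (\<open>triple_cocartesian\<close>). This is the Beck--Chevalley condition in the form
  of \<open>beck_chevalley_cocartesian\<close>: over a pullback square, a commuting square in the total category with
  one side cocartesian and the two adjacent sides cartesian has its fourth side cocartesian. The mate in
  the usual formulation is precisely the comparison of that fourth side with the chosen
  cocartesian lifting, so its invertibility gives the claim. Finite limits supply the object of
  composable triples.\<close>

section \<open>Pullbacks from finite limits\<close>

text \<open>The category \<open>0 \<rightarrow> 2 \<leftarrow> 1\<close>: the arrows 0, 1, 2 are the identities, 3 is \<open>0 \<rightarrow> 2\<close> and 4 is \<open>1 \<rightarrow> 2\<close>. A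
  composable pair always contains an identity, so composition returns the other arrow.\<close>
definition cospan_cat :: "(nat, nat) cat" where
  "cospan_cat = \<lparr>Obj = {0, 1, 2}, Arr = {0, 1, 2, 3, 4},
     Dom = (\<lambda>a. if a = 3 then 0 else if a = 4 then 1 else a),
     Cod = (\<lambda>a. if a = 3 \<or> a = 4 then 2 else a),
     Ide = (\<lambda>x. x),
     Comp = (\<lambda>b a. if b = 3 \<or> b = 4 then b else a)\<rparr>"

definition cospan_fctr :: "('o, 'a, 'm) cat_scheme \<Rightarrow> 'a \<Rightarrow> 'a \<Rightarrow> (nat, nat, 'o, 'a) fctr" where
  "cospan_fctr C f g = \<lparr>
     fobj = (\<lambda>x. if x = 0 then Dom C f else if x = 1 then Dom C g else Cod C f),
     farr = (\<lambda>a. if a = 3 then f else if a = 4 then g else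
       Ide C (if a = 0 then Dom C f else if a = 1 then Dom C g else Cod C f))\<rparr>"

lemma cospan_category: "category cospan_cat"
  by unfold_locales (auto simp: cospan_cat_def hom_def split: if_splits)

lemma cospan_is_functor:
  assumes "category C" and f: "f \<in> hom C X Z" and g: "g \<in> hom C Y Z"
  shows "is_functor cospan_cat C (cospan_fctr C f g)"
proof -
  interpret C: category C by fact
  interpret J: category cospan_cat by (rule cospan_category)
  have fa: "f \<in> Arr C" "Dom C f = X" "Cod C f = Z" and ga: "g \<in> Arr C" "Dom C g = Y" "Cod C g = Z"
    using f g by (auto simp: hom_def)
  have ob: "X \<in> Obj C" "Y \<in> Obj C" "Z \<in> Obj C"
    using fa ga C.Dom_Obj C.Cod_Obj by auto
  have ids: "Ide C X \<in> hom C X X" "Ide C Y \<in> hom C Y Y" "Ide C Z \<in> hom C Z Z"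
    using C.Ide_hom ob by auto
  have eqs: "Comp C (Ide C Z) f = f" "Comp C (Ide C Z) g = g"
      "Comp C f (Ide C X) = f" "Comp C g (Ide C Y) = g"
      "Comp C (Ide C X) (Ide C X) = Ide C X" "Comp C (Ide C Y) (Ide C Y) = Ide C Y"
      "Comp C (Ide C Z) (Ide C Z) = Ide C Z"
    using C.Comp_Ide_left C.Comp_Ide_right f g ids by auto
  show ?thesis
  proof
    fix x assume "x \<in> Obj cospan_cat"
    then show "fobj (cospan_fctr C f g) x \<in> Obj C"
      "farr (cospan_fctr C f g) (Ide cospan_cat x) = Ide C (fobj (cospan_fctr C f g) x)"
      using ob fa ga by (auto simp: cospan_cat_def cospan_fctr_def)
  next
    fix a x y assume "a \<in> hom cospan_cat x y"
    then show "farr (cospan_fctr C f g) a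
        \<in> hom C (fobj (cospan_fctr C f g) x) (fobj (cospan_fctr C f g) y)"
      using ids fa ga by (auto simp: cospan_cat_def cospan_fctr_def hom_def)
  next
    fix a b x y z assume "a \<in> hom cospan_cat x y" "b \<in> hom cospan_cat y z"
    then show "farr (cospan_fctr C f g) (Comp cospan_cat b a)
        = Comp C (farr (cospan_fctr C f g) b) (farr (cospan_fctr C f g) a)"
      using fa ga eqs by (auto simp: cospan_cat_def cospan_fctr_def hom_def split: if_splits)
  qed
qed

text \<open>The leg at the vertex 2 is determined by the other two, so a cone is a commutative square.\<close>
lemma cospan_cone_iff:
  assumes "category C" and f: "f \<in> hom C X Z" and g: "g \<in> hom C Y Z"
  shows "is_cone cospan_cat C (cospan_fctr C f g) N \<nu> \<longleftrightarrow>
     \<nu> 0 \<in> hom C N X \<and> \<nu> 1 \<in> hom C N Y \<and> \<nu> 2 = Comp C f (\<nu> 0) \<and> \<nu> 2 = Comp C g (\<nu> 1)"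
proof -
  interpret C: category C by fact
  have fa: "f \<in> Arr C" "Dom C f = X" "Cod C f = Z" and ga: "g \<in> Arr C" "Dom C g = Y" "Cod C g = Z"
    using f g by (auto simp: hom_def)
  have N: "N \<in> Obj C" if "a \<in> hom C N X" for a
    using that C.Dom_Obj by (auto simp: hom_def)
  have id: "Comp C (Ide C V) a = a" if "a \<in> hom C N V" for a V
    using C.Comp_Ide_left that by blast
  show ?thesis
    unfolding is_cone_def
    using fa ga N id C.Comp_hom[OF _ f] by (auto simp: cospan_cat_def cospan_fctr_def)
qed

lemma pullback_exists:
  assumes "category C" "has_finite_limits C" and f: "f \<in> hom C X Z" and g: "g \<in> hom C Y Z"
  shows "\<exists>k h. is_pullback C k h f g"
proof -
  interpret C: category C by fact
  let ?F = "cospan_fctr C f g"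
  note cone = cospan_cone_iff[OF assms(1) f g]
  have fa: "f \<in> Arr C" "Dom C f = X" "Cod C f = Z" and ga: "g \<in> Arr C" "Dom C g = Y" "Cod C g = Z"
    using f g by (auto simp: hom_def)
  have "finite (Obj cospan_cat)" "finite (Arr cospan_cat)"
    by (auto simp: cospan_cat_def)
  then obtain L \<pi> where L: "is_limit cospan_cat C ?F L \<pi>"
    using assms(2) cospan_is_functor[OF assms(1) f g] unfolding has_finite_limits_def by blast
  then have \<pi>: "\<pi> 0 \<in> hom C L X" "\<pi> 1 \<in> hom C L Y" "\<pi> 2 = Comp C f (\<pi> 0)"
      "Comp C f (\<pi> 0) = Comp C g (\<pi> 1)"
    unfolding is_limit_def cone by auto
  have univ: "\<exists>!u. u \<in> hom C V L \<and> Comp C (\<pi> 0) u = a \<and> Comp C (\<pi> 1) u = b"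
    if a: "a \<in> hom C V X" and b: "b \<in> hom C V Y" and ab: "Comp C f a = Comp C g b" for V a b
  proof -
    define \<nu> where "\<nu> = (\<lambda>j::nat. if j = 0 then a else if j = 1 then b else Comp C f a)"
    have "is_cone cospan_cat C ?F V \<nu>"
      unfolding cone using a b ab by (simp add: \<nu>_def)
    then have "\<exists>!u. u \<in> hom C V L \<and> (\<forall>j \<in> Obj cospan_cat. Comp C (\<pi> j) u = \<nu> j)"
      using L unfolding is_limit_def by blast
    moreover have "(\<forall>j \<in> Obj cospan_cat. Comp C (\<pi> j) u = \<nu> j) \<longleftrightarrow>
        Comp C (\<pi> 0) u = a \<and> Comp C (\<pi> 1) u = b" if "u \<in> hom C V L" for u
      using \<pi> C.Comp_assoc[OF that \<pi>(1) f] by (auto simp: cospan_cat_def \<nu>_def)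
    ultimately show ?thesis by (metis (no_types, lifting))
  qed
  have "is_pullback C (\<pi> 0) (\<pi> 1) f g"
    unfolding is_pullback_def using \<pi> fa ga univ by (auto simp: hom_def)
  then show ?thesis by blast
qed

lemma is_pullback_sym:
  assumes "is_pullback C k h f g" shows "is_pullback C h k g f"
proof -
  have "\<exists>!u. u \<in> hom C V (Dom C h) \<and> Comp C h u = b \<and> Comp C k u = a"
    if "a \<in> hom C V (Dom C f)" "b \<in> hom C V (Dom C g)" "Comp C f a = Comp C g b" for V a b
  proof -
    have "\<exists>!u. u \<in> hom C V (Dom C k) \<and> Comp C k u = a \<and> Comp C h u = b" and "Dom C k = Dom C h"
      using assms that unfolding is_pullback_def by blast+
    then show ?thesis by metis
  qed
  then show ?thesis
    using assms unfolding is_pullback_def by simp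
qed


section \<open>Arrows over a given arrow of the base\<close>

context bifibration
begin

abbreviation tcomp  (infixr "\<bullet>" 70) where "g \<bullet> f \<equiv> Comp (total P) g f"
abbreviation bcomp  (infixr "\<odot>" 70) where "g \<odot> f \<equiv> Comp (base P) g f"

text \<open>The base arrow is kept as an index. The arrows of the fibre over \<open>X\<close> are then those with index
  \<open>Ide X\<close>, and the side conditions of the universal properties become bookkeeping of indices.\<close>
definition lift where
  "lift f x y = {\<phi> \<in> hom (total P) x y. farr (proj P) \<phi> = f}"

lemma hom_fibre: "hom (fibre P X) x y = lift (Ide (base P) X) x y"
  by (auto simp: hom_def fibre_def lift_def)

lemma lift_hom_base: "\<phi> \<in> lift f x y \<Longrightarrow> f \<in> hom (base P) (fobj (proj P) x) (fobj (proj P) y)"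
  using farr_hom by (auto simp: lift_def)

lemma lift_Dom_Cod:
  "\<phi> \<in> lift f x y \<Longrightarrow> Dom (total P) \<phi> = x" "\<phi> \<in> lift f x y \<Longrightarrow> Cod (total P) \<phi> = y"
  "\<phi> \<in> lift f x y \<Longrightarrow> \<phi> \<in> Arr (total P)" "\<phi> \<in> lift f x y \<Longrightarrow> farr (proj P) \<phi> = f"
  by (auto simp: lift_def hom_def)

lemma lift_Obj:
  "\<phi> \<in> lift f x y \<Longrightarrow> x \<in> Obj (total P)" "\<phi> \<in> lift f x y \<Longrightarrow> y \<in> Obj (total P)"
  using A.Dom_Obj A.Cod_Obj by (auto simp: lift_def hom_def)

lemma lift_Comp: "\<phi> \<in> lift f x y \<Longrightarrow> \<psi> \<in> lift g y z \<Longrightarrow> \<psi> \<bullet> \<phi> \<in> lift (g \<odot> f) x z"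
  using A.Comp_hom farr_Comp by (auto simp: lift_def)

lemma lift_Ide: "x \<in> Obj (total P) \<Longrightarrow> Ide (total P) x \<in> lift (Ide (base P) (fobj (proj P) x)) x x"
  using A.Ide_hom farr_Ide by (auto simp: lift_def)

lemma lift_assoc:
  "\<phi> \<in> lift f w x \<Longrightarrow> \<psi> \<in> lift g x y \<Longrightarrow> \<theta> \<in> lift h y z \<Longrightarrow> (\<theta> \<bullet> \<psi>) \<bullet> \<phi> = \<theta> \<bullet> \<psi> \<bullet> \<phi>"
  using A.Comp_assoc by (auto simp: lift_def)

lemma lift_Ide_left: "\<phi> \<in> lift f x y \<Longrightarrow> Ide (total P) y \<bullet> \<phi> = \<phi>"
  using A.Comp_Ide_left by (auto simp: lift_def)

lemma lift_Ide_right: "\<phi> \<in> lift f x y \<Longrightarrow> \<phi> \<bullet> Ide (total P) x = \<phi>"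
  using A.Comp_Ide_right by (auto simp: lift_def)

lemma lift_Comp_vertical:
  assumes f: "f \<in> hom (base P) X Y" and \<phi>: "\<phi> \<in> lift f x y"
  shows "\<psi> \<in> lift (Ide (base P) Y) y z \<Longrightarrow> \<psi> \<bullet> \<phi> \<in> lift f x z"
    and "\<theta> \<in> lift (Ide (base P) X) w x \<Longrightarrow> \<phi> \<bullet> \<theta> \<in> lift f w y"
  using lift_Comp[OF \<phi>] lift_Comp[OF _ \<phi>] B.Comp_Ide_left[OF f] B.Comp_Ide_right[OF f] by force+

lemma lift_proj:
  assumes "f \<in> hom (base P) X Y" "\<phi> \<in> lift f x y"
  shows "fobj (proj P) x = X" "fobj (proj P) y = Y"
  using lift_hom_base[OF assms(2)] assms(1) by (auto simp: hom_def)

lemma fibre_category: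
  assumes X: "X \<in> Obj (base P)" shows "category (fibre P X)"
proof -
  have *: "Ide (base P) X \<in> hom (base P) X X"
    using B.Ide_hom X by blast
  have sel: "Comp (fibre P X) = Comp (total P)" "Ide (fibre P X) = Ide (total P)"
      "Dom (fibre P X) = Dom (total P)" "Cod (fibre P X) = Cod (total P)"
    by (auto simp: fibre_def)
  show ?thesis
  proof
    fix \<phi> assume "\<phi> \<in> Arr (fibre P X)"
    then have "\<phi> \<in> lift (Ide (base P) X) (Dom (total P) \<phi>) (Cod (total P) \<phi>)"
      by (auto simp: fibre_def lift_def hom_def)
    then show "Dom (fibre P X) \<phi> \<in> Obj (fibre P X)" "Cod (fibre P X) \<phi> \<in> Obj (fibre P X)"
      using lift_proj[OF *] lift_Obj by (auto simp: fibre_def)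
  next
    fix x assume "x \<in> Obj (fibre P X)"
    then show "Ide (fibre P X) x \<in> hom (fibre P X) x x"
      using lift_Ide by (auto simp: hom_fibre sel) (auto simp: fibre_def)
  qed (use lift_Comp_vertical[OF *] lift_Ide_left lift_Ide_right lift_assoc in
        \<open>auto simp: hom_fibre sel\<close>)
qed


section \<open>Cartesian and cocartesian arrows\<close>

lemma cartesian_factor:
  assumes "is_cartesian P b" "b \<in> lift f x y" "\<psi> \<in> lift (f \<odot> w) z y"
    and "w \<in> hom (base P) (fobj (proj P) z) (fobj (proj P) x)"
  shows "\<exists>!\<chi>. \<chi> \<in> lift w z x \<and> b \<bullet> \<chi> = \<psi>"
proof -
  have "\<exists>!\<chi>. \<chi> \<in> hom (total P) z (Dom (total P) b) \<and> farr (proj P) \<chi> = w \<and> b \<bullet> \<chi> = \<psi>"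
    using assms lift_Obj[OF assms(3)] unfolding is_cartesian_def by (auto simp: lift_def hom_def)
  then show ?thesis
    using lift_Dom_Cod(1)[OF assms(2)] by (simp add: lift_def conj_assoc)
qed

lemma cocartesian_factor:
  assumes "is_cocartesian P a" "a \<in> lift f x y" "\<psi> \<in> lift (w \<odot> f) x z"
    and "w \<in> hom (base P) (fobj (proj P) y) (fobj (proj P) z)"
  shows "\<exists>!\<chi>. \<chi> \<in> lift w y z \<and> \<chi> \<bullet> a = \<psi>"
proof -
  have "\<exists>!\<chi>. \<chi> \<in> hom (total P) (Cod (total P) a) z \<and> farr (proj P) \<chi> = w \<and> \<chi> \<bullet> a = \<psi>"
    using assms lift_Obj[OF assms(3)] unfolding is_cocartesian_def by (auto simp: lift_def hom_def)
  then show ?thesis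
    using lift_Dom_Cod(2)[OF assms(2)] by (simp add: lift_def conj_assoc)
qed

lemma cartesian_cancel:
  assumes "is_cartesian P b" "b \<in> lift f x y" "\<chi> \<in> lift w z x" "\<chi>' \<in> lift w z x"
    and "b \<bullet> \<chi> = b \<bullet> \<chi>'"
  shows "\<chi> = \<chi>'"
  using cartesian_factor[OF assms(1,2) lift_Comp[OF assms(3,2)] lift_hom_base[OF assms(3)]]
    assms(3-5) by auto

lemma cocartesian_cancel:
  assumes "is_cocartesian P a" "a \<in> lift f x y" "\<chi> \<in> lift w y z" "\<chi>' \<in> lift w y z"
    and "\<chi> \<bullet> a = \<chi>' \<bullet> a"
  shows "\<chi> = \<chi>'"
  using cocartesian_factor[OF assms(1,2) lift_Comp[OF assms(2,3)] lift_hom_base[OF assms(3)]]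
    assms(3-5) by auto

text \<open>Existence and uniqueness of factorisations are separate premises because they have separate
  proofs in all the applications below.\<close>
lemma cartesianI:
  assumes b: "b \<in> lift f x y"
    and "\<And>\<psi> w z. \<psi> \<in> lift (f \<odot> w) z y \<Longrightarrow>
      w \<in> hom (base P) (fobj (proj P) z) (fobj (proj P) x) \<Longrightarrow>
      \<exists>\<chi>. \<chi> \<in> lift w z x \<and> b \<bullet> \<chi> = \<psi>"
    and "\<And>\<chi> \<chi>' w z. \<chi> \<in> lift w z x \<Longrightarrow> \<chi>' \<in> lift w z x \<Longrightarrow> b \<bullet> \<chi> = b \<bullet> \<chi>' \<Longrightarrow> \<chi> = \<chi>'"
  shows "is_cartesian P b"
proof -
  have "\<exists>!\<chi>. \<chi> \<in> lift w z x \<and> b \<bullet> \<chi> = \<psi>"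
    if "\<psi> \<in> lift (f \<odot> w) z y" "w \<in> hom (base P) (fobj (proj P) z) (fobj (proj P) x)" for \<psi> w z
    using assms(2)[OF that] assms(3) by blast
  then show ?thesis
    using lift_Dom_Cod[OF b] unfolding is_cartesian_def by (simp add: lift_def conj_assoc)
qed

lemma cocartesianI:
  assumes a: "a \<in> lift f x y"
    and "\<And>\<psi> w z. \<psi> \<in> lift (w \<odot> f) x z \<Longrightarrow>
      w \<in> hom (base P) (fobj (proj P) y) (fobj (proj P) z) \<Longrightarrow>
      \<exists>\<chi>. \<chi> \<in> lift w y z \<and> \<chi> \<bullet> a = \<psi>"
    and "\<And>\<chi> \<chi>' w z. \<chi> \<in> lift w y z \<Longrightarrow> \<chi>' \<in> lift w y z \<Longrightarrow> \<chi> \<bullet> a = \<chi>' \<bullet> a \<Longrightarrow> \<chi> = \<chi>'"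
  shows "is_cocartesian P a"
proof -
  have "\<exists>!\<chi>. \<chi> \<in> lift w y z \<and> \<chi> \<bullet> a = \<psi>"
    if "\<psi> \<in> lift (w \<odot> f) x z" "w \<in> hom (base P) (fobj (proj P) y) (fobj (proj P) z)" for \<psi> w z
    using assms(2)[OF that] assms(3) by blast
  then show ?thesis
    using lift_Dom_Cod[OF a] unfolding is_cocartesian_def by (simp add: lift_def conj_assoc)
qed

lemma cartesian_Comp:
  assumes c: "is_cartesian P c" "c \<in> lift g y z" and b: "is_cartesian P b" "b \<in> lift f x y"
  shows "is_cartesian P (c \<bullet> b)"
proof (rule cartesianI)
  note g = lift_hom_base[OF c(2)] and f = lift_hom_base[OF b(2)]
  show "c \<bullet> b \<in> lift (g \<odot> f) x z"
    using lift_Comp b c by blast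
  show "\<exists>\<chi>. \<chi> \<in> lift w v x \<and> (c \<bullet> b) \<bullet> \<chi> = \<psi>"
    if \<psi>: "\<psi> \<in> lift ((g \<odot> f) \<odot> w) v z" and w: "w \<in> hom (base P) (fobj (proj P) v) (fobj (proj P) x)"
    for \<psi> w v
  proof -
    have "\<psi> \<in> lift (g \<odot> f \<odot> w) v z"
      using \<psi> B.Comp_assoc[OF w f g] by simp
    then obtain \<chi>1 where \<chi>1: "\<chi>1 \<in> lift (f \<odot> w) v y" "c \<bullet> \<chi>1 = \<psi>"
      using cartesian_factor[OF c _ B.Comp_hom[OF w f]] by blast
    then obtain \<chi> where "\<chi> \<in> lift w v x" "b \<bullet> \<chi> = \<chi>1"
      using cartesian_factor[OF b _ w] by blast
    then show ?thesis
      using \<chi>1 lift_assoc b c by blast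
  qed
  show "\<chi> = \<chi>'" if "\<chi> \<in> lift w v x" "\<chi>' \<in> lift w v x" "(c \<bullet> b) \<bullet> \<chi> = (c \<bullet> b) \<bullet> \<chi>'" for \<chi> \<chi>' w v
  proof -
    have "c \<bullet> b \<bullet> \<chi> = c \<bullet> b \<bullet> \<chi>'"
      using that lift_assoc[OF _ b(2) c(2)] by metis
    then have "b \<bullet> \<chi> = b \<bullet> \<chi>'"
      using cartesian_cancel[OF c] lift_Comp[OF _ b(2)] that by blast
    then show ?thesis
      using cartesian_cancel[OF b] that by blast
  qed
qed

lemma cocartesian_Comp:
  assumes c: "is_cocartesian P c" "c \<in> lift g y z" and b: "is_cocartesian P b" "b \<in> lift f x y"
  shows "is_cocartesian P (c \<bullet> b)"
proof (rule cocartesianI)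
  note g = lift_hom_base[OF c(2)] and f = lift_hom_base[OF b(2)]
  show "c \<bullet> b \<in> lift (g \<odot> f) x z"
    using lift_Comp b c by blast
  show "\<exists>\<chi>. \<chi> \<in> lift w z v \<and> \<chi> \<bullet> c \<bullet> b = \<psi>"
    if \<psi>: "\<psi> \<in> lift (w \<odot> g \<odot> f) x v" and w: "w \<in> hom (base P) (fobj (proj P) z) (fobj (proj P) v)"
    for \<psi> w v
  proof -
    have "\<psi> \<in> lift ((w \<odot> g) \<odot> f) x v"
      using \<psi> B.Comp_assoc[OF f g w] by simp
    then obtain \<chi>1 where \<chi>1: "\<chi>1 \<in> lift (w \<odot> g) y v" "\<chi>1 \<bullet> b = \<psi>"
      using cocartesian_factor[OF b _ B.Comp_hom[OF g w]] by blast
    then obtain \<chi> where "\<chi> \<in> lift w z v" "\<chi> \<bullet> c = \<chi>1"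
      using cocartesian_factor[OF c _ w] by blast
    then show ?thesis
      using \<chi>1 lift_assoc[OF b(2) c(2)] by metis
  qed
  show "\<chi> = \<chi>'" if "\<chi> \<in> lift w z v" "\<chi>' \<in> lift w z v" "\<chi> \<bullet> c \<bullet> b = \<chi>' \<bullet> c \<bullet> b" for \<chi> \<chi>' w v
  proof -
    have "(\<chi> \<bullet> c) \<bullet> b = (\<chi>' \<bullet> c) \<bullet> b"
      using that lift_assoc[OF b(2) c(2)] by metis
    then have "\<chi> \<bullet> c = \<chi>' \<bullet> c"
      using cocartesian_cancel[OF b] lift_Comp[OF c(2)] that by blast
    then show ?thesis
      using cocartesian_cancel[OF c] that by blast
  qed
qed

text \<open>Isomorphisms of the fibre over \<open>X\<close>, with the inverse named, since it is used in computations.\<close>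
definition vertical_inverses where
  "vertical_inverses X x y \<sigma> \<tau> \<longleftrightarrow> X \<in> Obj (base P) \<and>
     \<sigma> \<in> lift (Ide (base P) X) x y \<and> \<tau> \<in> lift (Ide (base P) X) y x \<and>
     \<tau> \<bullet> \<sigma> = Ide (total P) x \<and> \<sigma> \<bullet> \<tau> = Ide (total P) y"

lemma vertical_inverses_sym: "vertical_inverses X x y \<sigma> \<tau> \<Longrightarrow> vertical_inverses X y x \<tau> \<sigma>"
  by (auto simp: vertical_inverses_def)

lemma vertical_inverses_Comp:
  assumes "vertical_inverses X x y \<sigma> \<tau>"
  shows "\<phi> \<in> lift f z x \<Longrightarrow> \<tau> \<bullet> \<sigma> \<bullet> \<phi> = \<phi>"
    and "\<phi> \<in> lift f y z \<Longrightarrow> (\<phi> \<bullet> \<sigma>) \<bullet> \<tau> = \<phi>"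
proof -
  have v: "\<sigma> \<in> lift (Ide (base P) X) x y" "\<tau> \<in> lift (Ide (base P) X) y x"
      "\<tau> \<bullet> \<sigma> = Ide (total P) x" "\<sigma> \<bullet> \<tau> = Ide (total P) y"
    using assms by (auto simp: vertical_inverses_def)
  show "\<tau> \<bullet> \<sigma> \<bullet> \<phi> = \<phi>" if \<phi>: "\<phi> \<in> lift f z x"
    using lift_assoc[OF \<phi> v(1,2)] lift_Ide_left[OF \<phi>] v(3) by simp
  show "(\<phi> \<bullet> \<sigma>) \<bullet> \<tau> = \<phi>" if \<phi>: "\<phi> \<in> lift f y z"
    using lift_assoc[OF v(2,1) \<phi>] lift_Ide_right[OF \<phi>] v(4) by simp
qed

text \<open>Composing with a vertical arrow does not change the base arrow; here \<open>X\<close> is forced to be the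
  image of both \<open>x\<close> and \<open>y\<close>.\<close>
lemma vertical_lift_transport:
  assumes X: "X \<in> Obj (base P)" and \<sigma>: "\<sigma> \<in> lift (Ide (base P) X) x y"
  shows "\<phi> \<in> lift f z x \<Longrightarrow> \<sigma> \<bullet> \<phi> \<in> lift f z y"
    and "\<phi> \<in> lift f y z \<Longrightarrow> \<phi> \<bullet> \<sigma> \<in> lift f x z"
proof -
  have xy: "fobj (proj P) x = X" "fobj (proj P) y = X"
    using lift_proj[OF B.Ide_hom[OF X] \<sigma>] by auto
  show "\<sigma> \<bullet> \<phi> \<in> lift f z y" if \<phi>: "\<phi> \<in> lift f z x"
    using lift_Comp_vertical(1)[OF _ \<phi> \<sigma>] lift_hom_base[OF \<phi>] xy by simp
  show "\<phi> \<bullet> \<sigma> \<in> lift f x z" if \<phi>: "\<phi> \<in> lift f y z"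
    using lift_Comp_vertical(2)[OF _ \<phi> \<sigma>] lift_hom_base[OF \<phi>] xy by simp
qed

lemma vertical_iso_cartesian:
  assumes v: "vertical_inverses X x y \<sigma> \<tau>" shows "is_cartesian P \<sigma>"
proof (rule cartesianI)
  have X: "X \<in> Obj (base P)" and st: "\<sigma> \<in> lift (Ide (base P) X) x y" "\<tau> \<in> lift (Ide (base P) X) y x"
    using v by (auto simp: vertical_inverses_def)
  show "\<sigma> \<in> lift (Ide (base P) X) x y" by fact
  show "\<exists>\<chi>. \<chi> \<in> lift w z x \<and> \<sigma> \<bullet> \<chi> = \<psi>"
    if \<psi>: "\<psi> \<in> lift (Ide (base P) X \<odot> w) z y"
      and w: "w \<in> hom (base P) (fobj (proj P) z) (fobj (proj P) x)" for \<psi> w z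
  proof -
    have "\<psi> \<in> lift w z y"
      using \<psi> w B.Comp_Ide_left lift_proj[OF B.Ide_hom[OF X] st(1)] by metis
    then show ?thesis
      using vertical_lift_transport(1)[OF X st(2)]
        vertical_inverses_Comp(1)[OF vertical_inverses_sym[OF v]] by blast
  qed
  show "\<chi> = \<chi>'" if "\<chi> \<in> lift w z x" "\<chi>' \<in> lift w z x" "\<sigma> \<bullet> \<chi> = \<sigma> \<bullet> \<chi>'" for \<chi> \<chi>' w z
    using that vertical_inverses_Comp(1)[OF v] by metis
qed

lemma vertical_iso_cocartesian:
  assumes v: "vertical_inverses X x y \<sigma> \<tau>" shows "is_cocartesian P \<sigma>"
proof (rule cocartesianI)
  have X: "X \<in> Obj (base P)" and st: "\<sigma> \<in> lift (Ide (base P) X) x y" "\<tau> \<in> lift (Ide (base P) X) y x"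
    using v by (auto simp: vertical_inverses_def)
  show "\<sigma> \<in> lift (Ide (base P) X) x y" by fact
  show "\<exists>\<chi>. \<chi> \<in> lift w y z \<and> \<chi> \<bullet> \<sigma> = \<psi>"
    if \<psi>: "\<psi> \<in> lift (w \<odot> Ide (base P) X) x z"
      and w: "w \<in> hom (base P) (fobj (proj P) y) (fobj (proj P) z)" for \<psi> w z
  proof -
    have "\<psi> \<in> lift w x z"
      using \<psi> w B.Comp_Ide_right lift_proj[OF B.Ide_hom[OF X] st(1)] by metis
    then show ?thesis
      using vertical_lift_transport(2)[OF X st(2)]
        vertical_inverses_Comp(2)[OF vertical_inverses_sym[OF v]] by blast
  qed
  show "\<chi> = \<chi>'" if "\<chi> \<in> lift w y z" "\<chi>' \<in> lift w y z" "\<chi> \<bullet> \<sigma> = \<chi>' \<bullet> \<sigma>" for \<chi> \<chi>' w z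
    using that vertical_inverses_Comp(2)[OF v] by metis
qed

lemma cartesian_lifts_isomorphic:
  assumes b: "is_cartesian P b" "b \<in> lift f x y" and c: "is_cartesian P c" "c \<in> lift f z y"
  obtains \<sigma> \<tau> where "vertical_inverses (fobj (proj P) x) x z \<sigma> \<tau>" "c \<bullet> \<sigma> = b"
proof -
  define X where "X = fobj (proj P) x"
  have f: "f \<in> hom (base P) X (fobj (proj P) y)"
    using lift_hom_base[OF b(2)] by (simp add: X_def)
  have z: "fobj (proj P) z = X"
    using lift_proj[OF f c(2)] by simp
  have X: "X \<in> Obj (base P)" and I: "Ide (base P) X \<in> hom (base P) X X"
    using f B.Dom_Obj B.Ide_hom by (auto simp: hom_def)
  have fI: "f \<odot> Ide (base P) X = f"
    using B.Comp_Ide_right f by blast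
  obtain \<sigma> where s: "\<sigma> \<in> lift (Ide (base P) X) x z" "c \<bullet> \<sigma> = b"
    using cartesian_factor[OF c, of b "Ide (base P) X" x] b I z fI X_def by auto
  obtain \<tau> where t: "\<tau> \<in> lift (Ide (base P) X) z x" "b \<bullet> \<tau> = c"
    using cartesian_factor[OF b, of c "Ide (base P) X" z] c I z fI X_def by auto
  have ids: "Ide (total P) x \<in> lift (Ide (base P) X) x x" "Ide (total P) z \<in> lift (Ide (base P) X) z z"
    using lift_Ide[of x] lift_Ide[of z] lift_Obj b c z X_def by auto
  have "\<tau> \<bullet> \<sigma> = Ide (total P) x"
    using cartesian_cancel[OF b _ ids(1)] vertical_lift_transport(1)[OF X t(1) s(1)]
      lift_assoc[OF s(1) t(1) b(2)] lift_Ide_right[OF b(2)] s t by metis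
  moreover have "\<sigma> \<bullet> \<tau> = Ide (total P) z"
    using cartesian_cancel[OF c _ ids(2)] vertical_lift_transport(1)[OF X s(1) t(1)]
      lift_assoc[OF t(1) s(1) c(2)] lift_Ide_right[OF c(2)] s t by metis
  ultimately show thesis
    using that X s t by (simp add: vertical_inverses_def X_def)
qed

lemma cocartesian_lifts_isomorphic:
  assumes b: "is_cocartesian P b" "b \<in> lift f x y" and c: "is_cocartesian P c" "c \<in> lift f x z"
  obtains \<sigma> \<tau> where "vertical_inverses (fobj (proj P) y) y z \<sigma> \<tau>" "\<sigma> \<bullet> b = c"
proof -
  define Y where "Y = fobj (proj P) y"
  have f: "f \<in> hom (base P) (fobj (proj P) x) Y"
    using lift_hom_base[OF b(2)] by (simp add: Y_def)
  have z: "fobj (proj P) z = Y"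
    using lift_proj[OF f c(2)] by simp
  have Y: "Y \<in> Obj (base P)" and I: "Ide (base P) Y \<in> hom (base P) Y Y"
    using f B.Cod_Obj B.Ide_hom by (auto simp: hom_def)
  have fI: "Ide (base P) Y \<odot> f = f"
    using B.Comp_Ide_left f by blast
  obtain \<sigma> where s: "\<sigma> \<in> lift (Ide (base P) Y) y z" "\<sigma> \<bullet> b = c"
    using cocartesian_factor[OF b, of c "Ide (base P) Y" z] c I z fI Y_def by auto
  obtain \<tau> where t: "\<tau> \<in> lift (Ide (base P) Y) z y" "\<tau> \<bullet> c = b"
    using cocartesian_factor[OF c, of b "Ide (base P) Y" y] b I z fI Y_def by auto
  have ids: "Ide (total P) y \<in> lift (Ide (base P) Y) y y" "Ide (total P) z \<in> lift (Ide (base P) Y) z z"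
    using lift_Ide[of y] lift_Ide[of z] lift_Obj b c z Y_def by auto
  have "\<tau> \<bullet> \<sigma> = Ide (total P) y"
    using cocartesian_cancel[OF b _ ids(1)] vertical_lift_transport(1)[OF Y t(1) s(1)]
      lift_assoc[OF b(2) s(1) t(1)] lift_Ide_left[OF b(2)] s t by metis
  moreover have "\<sigma> \<bullet> \<tau> = Ide (total P) z"
    using cocartesian_cancel[OF c _ ids(2)] vertical_lift_transport(1)[OF Y s(1) t(1)]
      lift_assoc[OF c(2) t(1) s(1)] lift_Ide_left[OF c(2)] s t by metis
  ultimately show thesis
    using that Y s t by (simp add: vertical_inverses_def Y_def)
qed


section \<open>Change of base, direct image and the mate\<close>

lemma cart_pull:
  assumes "f \<in> hom (base P) X Y" "\<gamma> \<in> Obj (fibre P Y)"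
  shows "is_cartesian P (cart P f \<gamma>)" "cart P f \<gamma> \<in> lift f (fobj (pull P f) \<gamma>) \<gamma>"
    "fobj (pull P f) \<gamma> \<in> Obj (fibre P X)"
proof -
  show c: "is_cartesian P (cart P f \<gamma>)" and l: "cart P f \<gamma> \<in> lift f (fobj (pull P f) \<gamma>) \<gamma>"
    using cart_lift[OF assms] by (auto simp: lift_def hom_def pull_def is_cartesian_def)
  show "fobj (pull P f) \<gamma> \<in> Obj (fibre P X)"
    using lift_proj[OF assms(1) l] lift_Obj[OF l] by (simp add: fibre_def)
qed

lemma cocart_push:
  assumes "f \<in> hom (base P) X Y" "\<gamma> \<in> Obj (fibre P X)"
  shows "is_cocartesian P (cocart P f \<gamma>)" "cocart P f \<gamma> \<in> lift f \<gamma> (fobj (push P f) \<gamma>)"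
    "fobj (push P f) \<gamma> \<in> Obj (fibre P Y)"
proof -
  show c: "is_cocartesian P (cocart P f \<gamma>)" and l: "cocart P f \<gamma> \<in> lift f \<gamma> (fobj (push P f) \<gamma>)"
    using cocart_lift[OF assms] by (auto simp: lift_def hom_def push_def is_cocartesian_def)
  show "fobj (push P f) \<gamma> \<in> Obj (fibre P Y)"
    using lift_proj[OF assms(1) l] lift_Obj[OF l] by (simp add: fibre_def)
qed

lemma vertical_cartesian_factor:
  assumes f: "f \<in> hom (base P) X Y" and b: "is_cartesian P b" "b \<in> lift f x y"
    and \<psi>: "\<psi> \<in> lift f z y"
  shows "\<exists>!\<chi>. \<chi> \<in> lift (Ide (base P) X) z x \<and> b \<bullet> \<chi> = \<psi>"
proof (rule cartesian_factor[OF b])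
  show "\<psi> \<in> lift (f \<odot> Ide (base P) X) z y"
    using \<psi> B.Comp_Ide_right[OF f] by simp
  have "X \<in> Obj (base P)"
    using f B.Dom_Obj by (auto simp: hom_def)
  then show "Ide (base P) X \<in> hom (base P) (fobj (proj P) z) (fobj (proj P) x)"
    using lift_proj[OF f b(2)] lift_proj[OF f \<psi>] B.Ide_hom by simp
qed

lemma vertical_cocartesian_factor:
  assumes f: "f \<in> hom (base P) X Y" and a: "is_cocartesian P a" "a \<in> lift f x y"
    and \<psi>: "\<psi> \<in> lift f x z"
  shows "\<exists>!\<chi>. \<chi> \<in> lift (Ide (base P) Y) y z \<and> \<chi> \<bullet> a = \<psi>"
proof (rule cocartesian_factor[OF a])
  show "\<psi> \<in> lift (Ide (base P) Y \<odot> f) x z"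
    using \<psi> B.Comp_Ide_left[OF f] by simp
  have "Y \<in> Obj (base P)"
    using f B.Cod_Obj by (auto simp: hom_def)
  then show "Ide (base P) Y \<in> hom (base P) (fobj (proj P) y) (fobj (proj P) z)"
    using lift_proj[OF f a(2)] lift_proj[OF f \<psi>] B.Ide_hom by simp
qed

lemma fibre_Obj_lift:
  assumes "X \<in> Obj (base P)" "\<phi> \<in> lift (Ide (base P) X) x y"
  shows "x \<in> Obj (fibre P X)" "y \<in> Obj (fibre P X)"
  using lift_proj[OF B.Ide_hom[OF assms(1)] assms(2)] lift_Obj[OF assms(2)] by (auto simp: fibre_def)

lemma pull_arr:
  assumes f: "f \<in> hom (base P) X Y" and \<phi>: "\<phi> \<in> lift (Ide (base P) Y) \<gamma> \<gamma>'"
  shows "farr (pull P f) \<phi> \<in> lift (Ide (base P) X) (fobj (pull P f) \<gamma>) (fobj (pull P f) \<gamma>')"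
    and "cart P f \<gamma>' \<bullet> farr (pull P f) \<phi> = \<phi> \<bullet> cart P f \<gamma>"
proof -
  have Y: "Y \<in> Obj (base P)" and X: "Dom (base P) f = X"
    using f B.Cod_Obj by (auto simp: hom_def)
  note c = cart_pull[OF f fibre_Obj_lift(1)[OF Y \<phi>]]
  note c' = cart_pull[OF f fibre_Obj_lift(2)[OF Y \<phi>]]
  have "\<phi> \<bullet> cart P f \<gamma> \<in> lift f (fobj (pull P f) \<gamma>) \<gamma>'"
    using lift_Comp_vertical(1)[OF f c(2) \<phi>] .
  from theI'[OF vertical_cartesian_factor[OF f c'(1,2) this]]
  show "farr (pull P f) \<phi> \<in> lift (Ide (base P) X) (fobj (pull P f) \<gamma>) (fobj (pull P f) \<gamma>')"
    "cart P f \<gamma>' \<bullet> farr (pull P f) \<phi> = \<phi> \<bullet> cart P f \<gamma>"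
    using lift_Dom_Cod[OF \<phi>] X by (auto simp: pull_def hom_fibre Let_def)
qed

lemma push_arr:
  assumes f: "f \<in> hom (base P) X Y" and \<phi>: "\<phi> \<in> lift (Ide (base P) X) \<gamma> \<gamma>'"
  shows "farr (push P f) \<phi> \<in> lift (Ide (base P) Y) (fobj (push P f) \<gamma>) (fobj (push P f) \<gamma>')"
    and "farr (push P f) \<phi> \<bullet> cocart P f \<gamma> = cocart P f \<gamma>' \<bullet> \<phi>"
proof -
  have X: "X \<in> Obj (base P)" and Y: "Cod (base P) f = Y"
    using f B.Dom_Obj by (auto simp: hom_def)
  note c = cocart_push[OF f fibre_Obj_lift(1)[OF X \<phi>]]
  note c' = cocart_push[OF f fibre_Obj_lift(2)[OF X \<phi>]]
  have "cocart P f \<gamma>' \<bullet> \<phi> \<in> lift f \<gamma> (fobj (push P f) \<gamma>')"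
    using lift_Comp_vertical(2)[OF f c'(2) \<phi>] .
  from theI'[OF vertical_cocartesian_factor[OF f c(1,2) this]]
  show "farr (push P f) \<phi> \<in> lift (Ide (base P) Y) (fobj (push P f) \<gamma>) (fobj (push P f) \<gamma>')"
    "farr (push P f) \<phi> \<bullet> cocart P f \<gamma> = cocart P f \<gamma>' \<bullet> \<phi>"
    using lift_Dom_Cod[OF \<phi>] Y by (auto simp: push_def hom_fibre Let_def)
qed

lemma adj_unit_arr:
  assumes f: "f \<in> hom (base P) X Y" and \<gamma>: "\<gamma> \<in> Obj (fibre P X)"
  shows "adj_unit P f \<gamma> \<in> lift (Ide (base P) X) \<gamma> (fobj (pull P f) (fobj (push P f) \<gamma>))"
    and "cart P f (fobj (push P f) \<gamma>) \<bullet> adj_unit P f \<gamma> = cocart P f \<gamma>"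
proof -
  have X: "Dom (base P) f = X"
    using f by (auto simp: hom_def)
  note d = cocart_push[OF f \<gamma>]
  note c = cart_pull[OF f d(3)]
  from theI'[OF vertical_cartesian_factor[OF f c(1,2) d(2)]]
  show "adj_unit P f \<gamma> \<in> lift (Ide (base P) X) \<gamma> (fobj (pull P f) (fobj (push P f) \<gamma>))"
    and "cart P f (fobj (push P f) \<gamma>) \<bullet> adj_unit P f \<gamma> = cocart P f \<gamma>"
    unfolding adj_unit_def hom_fibre X by auto
qed

lemma adj_counit_arr:
  assumes f: "f \<in> hom (base P) X Y" and \<gamma>: "\<gamma> \<in> Obj (fibre P Y)"
  shows "adj_counit P f \<gamma> \<in> lift (Ide (base P) Y) (fobj (push P f) (fobj (pull P f) \<gamma>)) \<gamma>"
    and "adj_counit P f \<gamma> \<bullet> cocart P f (fobj (pull P f) \<gamma>) = cart P f \<gamma>"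
proof -
  have Y: "Cod (base P) f = Y"
    using f by (auto simp: hom_def)
  note c = cart_pull[OF f \<gamma>]
  note d = cocart_push[OF f c(3)]
  from theI'[OF vertical_cocartesian_factor[OF f d(1,2) c(2)]]
  show "adj_counit P f \<gamma> \<in> lift (Ide (base P) Y) (fobj (push P f) (fobj (pull P f) \<gamma>)) \<gamma>"
    and "adj_counit P f \<gamma> \<bullet> cocart P f (fobj (pull P f) \<gamma>) = cart P f \<gamma>"
    unfolding adj_counit_def hom_fibre Y by auto
qed

lemma pull_comparison_arr:
  assumes k: "k \<in> hom (base P) W X" and f: "f \<in> hom (base P) X Z"
    and h: "h \<in> hom (base P) W Y" and g: "g \<in> hom (base P) Y Z"
    and eq: "f \<odot> k = g \<odot> h" and \<gamma>: "\<gamma> \<in> Obj (fibre P Z)"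
  shows "pull_comparison P k h f g \<gamma> \<in> lift (Ide (base P) W)
      (fobj (pull P k) (fobj (pull P f) \<gamma>)) (fobj (pull P h) (fobj (pull P g) \<gamma>))"
    and "(cart P g \<gamma> \<bullet> cart P h (fobj (pull P g) \<gamma>)) \<bullet> pull_comparison P k h f g \<gamma>
      = cart P f \<gamma> \<bullet> cart P k (fobj (pull P f) \<gamma>)"
proof -
  have W: "Dom (base P) k = W"
    using k by (auto simp: hom_def)
  note cf = cart_pull[OF f \<gamma>]
  note ck = cart_pull[OF k cf(3)]
  note cg = cart_pull[OF g \<gamma>]
  note ch = cart_pull[OF h cg(3)]
  have "cart P f \<gamma> \<bullet> cart P k (fobj (pull P f) \<gamma>) \<in> lift (g \<odot> h) (fobj (pull P k) (fobj (pull P f) \<gamma>)) \<gamma>"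
    using lift_Comp[OF ck(2) cf(2)] eq by simp
  from theI'[OF vertical_cartesian_factor[OF B.Comp_hom[OF h g]
      cartesian_Comp[OF cg(1,2) ch(1,2)] lift_Comp[OF ch(2) cg(2)] this]]
  show "pull_comparison P k h f g \<gamma> \<in> lift (Ide (base P) W)
      (fobj (pull P k) (fobj (pull P f) \<gamma>)) (fobj (pull P h) (fobj (pull P g) \<gamma>))"
    and "(cart P g \<gamma> \<bullet> cart P h (fobj (pull P g) \<gamma>)) \<bullet> pull_comparison P k h f g \<gamma>
      = cart P f \<gamma> \<bullet> cart P k (fobj (pull P f) \<gamma>)"
    unfolding pull_comparison_def hom_fibre W by auto
qed

text \<open>The equation characterises the mate without units and counits: up to the chosen
  cocartesian lifting of \<open>h\<close>, it is the arrow over \<open>h\<close> that completes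
  \<open>k\<^sup>* \<gamma> \<rightarrow> \<gamma> \<rightarrow> f\<^sub>! \<gamma>\<close> to a commutative square over the given one. Each of the three factors
  of the mate is pushed past the liftings by its defining equation.\<close>
lemma mate_arr:
  assumes k: "k \<in> hom (base P) W X" and f: "f \<in> hom (base P) X Z"
    and h: "h \<in> hom (base P) W Y" and g: "g \<in> hom (base P) Y Z"
    and eq: "f \<odot> k = g \<odot> h" and \<gamma>: "\<gamma> \<in> Obj (fibre P X)"
  shows "mate P k h f g \<gamma> \<in> lift (Ide (base P) Y)
      (fobj (push P h) (fobj (pull P k) \<gamma>)) (fobj (pull P g) (fobj (push P f) \<gamma>))"
    and "cart P g (fobj (push P f) \<gamma>) \<bullet> mate P k h f g \<gamma> \<bullet> cocart P h (fobj (pull P k) \<gamma>)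
      = cocart P f \<gamma> \<bullet> cart P k \<gamma>"
proof -
  define \<delta> where "\<delta> = fobj (push P f) \<gamma>"
  define n c e where "n = adj_unit P f \<gamma>" "c = pull_comparison P k h f g \<delta>"
    "e = adj_counit P h (fobj (pull P g) \<delta>)"
  define kn where "kn = farr (pull P k) n"
  have W: "W \<in> Obj (base P)" and Y: "Y \<in> Obj (base P)"
    using k h B.Dom_Obj B.Cod_Obj by (auto simp: hom_def)
  have \<delta>: "\<delta> \<in> Obj (fibre P Z)"
    unfolding \<delta>_def by (rule cocart_push(3)[OF f \<gamma>])
  note cf = cart_pull[OF f \<delta>] and cg = cart_pull[OF g \<delta>]
  note ckf = cart_pull[OF k cf(3)] and chg = cart_pull[OF h cg(3)] and ck = cart_pull[OF k \<gamma>]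
  note n = adj_unit_arr[OF f \<gamma>, folded \<delta>_def n_c_e_def]
  note kn = pull_arr[OF k n(1), folded kn_def]
  note c = pull_comparison_arr[OF k f h g eq \<delta>, folded n_c_e_def]
  note e = adj_counit_arr[OF h cg(3), folded n_c_e_def]
  note hkn = push_arr[OF h kn(1)] and hc = push_arr[OF h c(1)]
  note dk = cocart_push[OF h ck(3)]
  note dkf = cocart_push[OF h ckf(3)]
  note dhg = cocart_push[OF h chg(3)]
  have mate: "mate P k h f g \<gamma> = e \<bullet> farr (push P h) c \<bullet> farr (push P h) kn"
    by (simp add: mate_def n_c_e_def kn_def \<delta>_def)
  note m1 = vertical_lift_transport(1)[OF Y hc(1) hkn(1)]
  show "mate P k h f g \<gamma> \<in> lift (Ide (base P) Y)
      (fobj (push P h) (fobj (pull P k) \<gamma>)) (fobj (pull P g) (fobj (push P f) \<gamma>))"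
    unfolding mate \<delta>_def[symmetric] by (rule vertical_lift_transport(1)[OF Y e(1) m1])
  have "mate P k h f g \<gamma> \<bullet> cocart P h (fobj (pull P k) \<gamma>)
      = e \<bullet> farr (push P h) c \<bullet> farr (push P h) kn \<bullet> cocart P h (fobj (pull P k) \<gamma>)"
    unfolding mate using lift_assoc[OF dk(2) m1 e(1)] lift_assoc[OF dk(2) hkn(1) hc(1)] by simp
  also have "\<dots> = e \<bullet> farr (push P h) c \<bullet> cocart P h (fobj (pull P k) (fobj (pull P f) \<delta>)) \<bullet> kn"
    by (simp only: hkn(2))
  also have "\<dots> = e \<bullet> (cocart P h (fobj (pull P h) (fobj (pull P g) \<delta>)) \<bullet> c) \<bullet> kn"
    using lift_assoc[OF kn(1) dkf(2) hc(1)] hc(2) by simp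
  also have "\<dots> = (e \<bullet> cocart P h (fobj (pull P h) (fobj (pull P g) \<delta>))) \<bullet> c \<bullet> kn"
    using lift_assoc[OF kn(1) c(1) dhg(2)] vertical_lift_transport(1)[OF W c(1) kn(1)]
      lift_assoc[OF _ dhg(2) e(1)] by simp
  also have "\<dots> = cart P h (fobj (pull P g) \<delta>) \<bullet> c \<bullet> kn"
    by (simp only: e(2))
  finally have *: "mate P k h f g \<gamma> \<bullet> cocart P h (fobj (pull P k) \<gamma>)
      = cart P h (fobj (pull P g) \<delta>) \<bullet> c \<bullet> kn" .
  have "cart P g \<delta> \<bullet> cart P h (fobj (pull P g) \<delta>) \<bullet> c \<bullet> kn
      = ((cart P g \<delta> \<bullet> cart P h (fobj (pull P g) \<delta>)) \<bullet> c) \<bullet> kn"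
    using lift_assoc[OF vertical_lift_transport(1)[OF W c(1) kn(1)] chg(2) cg(2)]
      lift_assoc[OF kn(1) c(1) lift_Comp[OF chg(2) cg(2)]] by simp
  also have "\<dots> = cart P f \<delta> \<bullet> n \<bullet> cart P k \<gamma>"
    using c(2) lift_assoc[OF kn(1) ckf(2) cf(2)] kn(2) by simp
  also have "\<dots> = cocart P f \<gamma> \<bullet> cart P k \<gamma>"
    using lift_assoc[OF ck(2) n(1) cf(2)] n(2) by simp
  finally show "cart P g (fobj (push P f) \<gamma>) \<bullet> mate P k h f g \<gamma> \<bullet> cocart P h (fobj (pull P k) \<gamma>)
      = cocart P f \<gamma> \<bullet> cart P k \<gamma>"
    unfolding * \<delta>_def[symmetric] .
qed

lemma fibre_iso_vertical_inverses:
  assumes X: "X \<in> Obj (base P)" and \<sigma>: "\<sigma> \<in> lift (Ide (base P) X) x y" and "iso (fibre P X) \<sigma>"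
  obtains \<tau> where "vertical_inverses X x y \<sigma> \<tau>"
proof -
  have "\<exists>\<tau> \<in> hom (fibre P X) y x. \<tau> \<bullet> \<sigma> = Ide (total P) x \<and> \<sigma> \<bullet> \<tau> = Ide (total P) y"
    using assms(3) lift_Dom_Cod(1,2)[OF \<sigma>] unfolding iso_def by (simp add: fibre_def)
  then show thesis
    using that X \<sigma> by (auto simp: hom_fibre vertical_inverses_def)
qed

text \<open>By \<open>mate_arr\<close> the fourth side of the square formed by the chosen liftings is the chosen cocartesian
  lifting of \<open>h\<close> followed by the mate, and the mate is a vertical isomorphism; so this side is
  cocartesian. Any other square of the same kind differs from this one by vertical isomorphisms at its
  corners. The freedom to use arbitrary liftings is essential for composable triples, where the
  side \<open>a\<close> is itself obtained from this lemma and is not a chosen lifting.\<close>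
lemma beck_chevalley_cocartesian:
  assumes bc: "beck_chevalley P" and pb: "is_pullback (base P) k h f g"
    and a: "is_cocartesian P a" "a \<in> lift f x y" and b: "is_cartesian P b" "b \<in> lift g y' y"
    and e: "is_cartesian P e" "e \<in> lift k x' x"
    and d: "d \<in> lift h x' y'" and square: "b \<bullet> d = a \<bullet> e"
  shows "is_cocartesian P d"
proof -
  define W X Y Z where "W = Dom (base P) k" "X = Dom (base P) f" "Y = Dom (base P) g" "Z = Cod (base P) f"
  have k: "k \<in> hom (base P) W X" and h: "h \<in> hom (base P) W Y"
    and f: "f \<in> hom (base P) X Z" and g: "g \<in> hom (base P) Y Z" and eq: "f \<odot> k = g \<odot> h"
    using pb by (auto simp: is_pullback_def hom_def W_X_Y_Z_def)
  have Y: "Y \<in> Obj (base P)"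
    using g B.Dom_Obj by (auto simp: hom_def)
  have x: "x \<in> Obj (fibre P X)"
    using lift_proj[OF f a(2)] lift_Obj[OF a(2)] by (simp add: fibre_def)
  note cf = cocart_push[OF f x]
  note cg = cart_pull[OF g cf(3)]
  note ck = cart_pull[OF k x]
  note ch = cocart_push[OF h ck(3)]
  note mate = mate_arr[OF k f h g eq x]
  have "natural_isomorphism (fibre P X) (fibre P Y)
      (push P h \<circ>\<^sub>F pull P k) (pull P g \<circ>\<^sub>F push P f) (mate P k h f g)"
    using bc pb unfolding beck_chevalley_def W_X_Y_Z_def by blast
  then have "iso (fibre P Y) (mate P k h f g x)"
    using x natural_isomorphism.component_iso by fastforce
  then obtain m where "vertical_inverses Y (fobj (push P h) (fobj (pull P k) x))
      (fobj (pull P g) (fobj (push P f) x)) (mate P k h f g x) m"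
    using fibre_iso_vertical_inverses[OF Y mate(1)] by blast
  note mate_cocart = vertical_iso_cocartesian[OF this]
  define d0 where "d0 = mate P k h f g x \<bullet> cocart P h (fobj (pull P k) x)"
  have d0: "is_cocartesian P d0"
    "d0 \<in> lift h (fobj (pull P k) x) (fobj (pull P g) (fobj (push P f) x))"
    "cart P g (fobj (push P f) x) \<bullet> d0 = cocart P f x \<bullet> cart P k x"
    unfolding d0_def using cocartesian_Comp[OF mate_cocart mate(1) ch(1,2)]
      vertical_lift_transport(1)[OF Y mate(1) ch(2)] mate(2) by auto
  \<comment> \<open>\<open>\<sigma>\<close>, \<open>\<rho>\<close> and \<open>\<tau>\<close> compare the corners \<open>y\<close>, \<open>x'\<close> and \<open>y'\<close> with those of the chosen square;
     the corner \<open>x\<close> is shared.\<close>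
  obtain \<sigma> \<sigma>' where \<sigma>: "vertical_inverses Z (fobj (push P f) x) y \<sigma> \<sigma>'" "\<sigma> \<bullet> cocart P f x = a"
    using cocartesian_lifts_isomorphic[OF cf(1,2) a] lift_proj[OF f cf(2)] by metis
  obtain \<rho> \<rho>' where \<rho>: "vertical_inverses W x' (fobj (pull P k) x) \<rho> \<rho>'" "cart P k x \<bullet> \<rho> = e"
    using cartesian_lifts_isomorphic[OF e ck(1,2)] lift_proj[OF k e(2)] by metis
  have Z: "Z \<in> Obj (base P)" and W: "W \<in> Obj (base P)"
    and \<sigma>l: "\<sigma> \<in> lift (Ide (base P) Z) (fobj (push P f) x) y"
    and \<rho>l: "\<rho> \<in> lift (Ide (base P) W) x' (fobj (pull P k) x)"
    using \<sigma> \<rho> by (auto simp: vertical_inverses_def)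
  have s: "is_cartesian P (\<sigma> \<bullet> cart P g (fobj (push P f) x))"
      "\<sigma> \<bullet> cart P g (fobj (push P f) x) \<in> lift g (fobj (pull P g) (fobj (push P f) x)) y"
    using cartesian_Comp[OF vertical_iso_cartesian[OF \<sigma>(1)] \<sigma>l cg(1,2)]
      vertical_lift_transport(1)[OF Z \<sigma>l cg(2)] by auto
  obtain \<tau> \<tau>' where \<tau>: "vertical_inverses Y (fobj (pull P g) (fobj (push P f) x)) y' \<tau> \<tau>'"
      "b \<bullet> \<tau> = \<sigma> \<bullet> cart P g (fobj (push P f) x)"
    using cartesian_lifts_isomorphic[OF s b] lift_proj[OF g cg(2)] by metis
  then have \<tau>l: "\<tau> \<in> lift (Ide (base P) Y) (fobj (pull P g) (fobj (push P f) x)) y'"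
    by (auto simp: vertical_inverses_def)
  have d0\<rho>: "is_cocartesian P (d0 \<bullet> \<rho>)"
      "d0 \<bullet> \<rho> \<in> lift h x' (fobj (pull P g) (fobj (push P f) x))"
    using cocartesian_Comp[OF d0(1,2) vertical_iso_cocartesian[OF \<rho>(1)] \<rho>l]
      vertical_lift_transport(2)[OF W \<rho>l d0(2)] by auto
  have t: "is_cocartesian P (\<tau> \<bullet> d0 \<bullet> \<rho>)" "\<tau> \<bullet> d0 \<bullet> \<rho> \<in> lift h x' y'"
    using cocartesian_Comp[OF vertical_iso_cocartesian[OF \<tau>(1)] \<tau>l d0\<rho>]
      vertical_lift_transport(1)[OF Y \<tau>l d0\<rho>(2)] by auto
  have "b \<bullet> \<tau> \<bullet> d0 \<bullet> \<rho> = (\<sigma> \<bullet> cart P g (fobj (push P f) x)) \<bullet> d0 \<bullet> \<rho>"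
    using lift_assoc[OF d0\<rho>(2) \<tau>l b(2)] \<tau>(2) by simp
  also have "\<dots> = \<sigma> \<bullet> (cart P g (fobj (push P f) x) \<bullet> d0) \<bullet> \<rho>"
    using lift_assoc[OF d0\<rho>(2) cg(2) \<sigma>l] lift_assoc[OF \<rho>l d0(2) cg(2)] by simp
  also have "\<dots> = \<sigma> \<bullet> cocart P f x \<bullet> e"
    using lift_assoc[OF \<rho>l ck(2) cf(2)] d0(3) \<rho>(2) by simp
  also have "\<dots> = b \<bullet> d"
    using lift_assoc[OF e(2) cf(2) \<sigma>l] \<sigma>(2) square by simp
  finally have "\<tau> \<bullet> d0 \<bullet> \<rho> = d"
    using cartesian_cancel[OF b t(2) d] by blast
  then show ?thesis
    using t(1) by simp
qed

end


section \<open>The action of internal arrows\<close>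

locale internal_category_in_bifibration =
  bifibration P + D: internal_category "base P" D
  for P :: "('o, 'a, 'p, 'b) bifib" and D :: "('o, 'a) internal_cat" +
  assumes beck_chevalley: "beck_chevalley P"
    and finite_limits: "has_finite_limits (base P)"
begin

abbreviation "D0 \<equiv> ob0 D"
abbreviation "D1 \<equiv> ob1 D"
abbreviation "D2 \<equiv> Dom (base P) (ipr1 D)"
abbreviation "src \<equiv> isrc D"
abbreviation "tgt \<equiv> itgt D"
abbreviation "idn \<equiv> iid D"
abbreviation "p1 \<equiv> ipr1 D"
abbreviation "p2 \<equiv> ipr2 D"
abbreviation "cmp \<equiv> icomp D"
abbreviation "T \<equiv> internal_fctr P D"
abbreviation "Tob \<equiv> fobj T"
abbreviation "vert \<equiv> lift (Ide (base P) D0)"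
abbreviation "src_pull \<equiv> fobj (pull P src)"
abbreviation "src_cart \<equiv> cart P src"

definition tgt_cocart where "tgt_cocart \<gamma> = cocart P tgt (src_pull \<gamma>)"

lemma pr_hom: "p1 \<in> hom (base P) D2 D1" "p2 \<in> hom (base P) D2 D1" "src \<odot> p1 = tgt \<odot> p2"
  using D.pairs_pullback D.isrc_hom D.itgt_hom by (auto simp: is_pullback_def hom_def)

lemma src_cart:
  assumes "\<gamma> \<in> Obj (fibre P D0)"
  shows "is_cartesian P (src_cart \<gamma>)" "src_cart \<gamma> \<in> lift src (src_pull \<gamma>) \<gamma>"
    "src_pull \<gamma> \<in> Obj (fibre P D1)"
  using cart_pull[OF D.isrc_hom assms] by auto

lemma Tob_eq: "Tob \<gamma> = fobj (push P tgt) (src_pull \<gamma>)"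
  by (simp add: internal_fctr_def comp_fctr_def)

lemma farr_T: "farr T \<phi> = farr (push P tgt) (farr (pull P src) \<phi>)"
  by (simp add: internal_fctr_def comp_fctr_def)

lemma tgt_cocart:
  assumes "\<gamma> \<in> Obj (fibre P D0)"
  shows "is_cocartesian P (tgt_cocart \<gamma>)" "tgt_cocart \<gamma> \<in> lift tgt (src_pull \<gamma>) (Tob \<gamma>)"
    "Tob \<gamma> \<in> Obj (fibre P D0)"
  using cocart_push[OF D.itgt_hom src_cart(3)[OF assms]] by (auto simp: tgt_cocart_def Tob_eq)

text \<open>If \<open>act\<close> is read as a family of maps, indexed by \<open>u\<close>, from arrows into \<open>\<gamma>\<close> over \<open>s u\<close> to arrows
  into \<open>T \<gamma>\<close> over \<open>t u\<close>, then \<open>T \<gamma>\<close> is the universal target of such a family that is natural in the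
  sense of \<open>act_precomp\<close>. The target \<open>\<gamma>\<close> is read off from \<open>\<psi>\<close>; the description applies when the image of \<open>\<psi>\<close>
  in the base is \<open>s u\<close>.\<close>
definition act where
  "act u \<psi> = (let \<gamma> = Cod (total P) \<psi> in tgt_cocart \<gamma> \<bullet>
     (THE \<chi>. \<chi> \<in> lift u (Dom (total P) \<psi>) (src_pull \<gamma>) \<and> src_cart \<gamma> \<bullet> \<chi> = \<psi>))"

lemma act_eq:
  assumes \<gamma>: "\<gamma> \<in> Obj (fibre P D0)" and \<chi>: "\<chi> \<in> lift u x (src_pull \<gamma>)"
  shows "act u (src_cart \<gamma> \<bullet> \<chi>) = tgt_cocart \<gamma> \<bullet> \<chi>"
proof -
  note c = src_cart[OF \<gamma>]
  have "(THE \<chi>'. \<chi>' \<in> lift u x (src_pull \<gamma>) \<and> src_cart \<gamma> \<bullet> \<chi>' = src_cart \<gamma> \<bullet> \<chi>) = \<chi>"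
    using \<chi> cartesian_cancel[OF c(1,2)] by blast
  then show ?thesis
    using lift_Dom_Cod[OF lift_Comp[OF \<chi> c(2)]] by (simp add: act_def Let_def)
qed

text \<open>Every arrow over \<open>s u\<close> is of the form treated in \<open>act_eq\<close>; this replaces the definition of \<open>act\<close>
  in what follows.\<close>
lemma act_factor:
  assumes u: "u \<in> hom (base P) V D1" and \<psi>: "\<psi> \<in> lift (src \<odot> u) x \<gamma>"
  obtains \<chi> where "\<gamma> \<in> Obj (fibre P D0)" "\<chi> \<in> lift u x (src_pull \<gamma>)" "\<psi> = src_cart \<gamma> \<bullet> \<chi>"
    "act u \<psi> = tgt_cocart \<gamma> \<bullet> \<chi>"
proof -
  have su: "src \<odot> u \<in> hom (base P) V D0"
    using B.Comp_hom[OF u D.isrc_hom] .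
  have \<gamma>: "\<gamma> \<in> Obj (fibre P D0)"
    using lift_proj[OF su \<psi>] lift_Obj[OF \<psi>] by (simp add: fibre_def)
  note c = src_cart[OF \<gamma>]
  have "u \<in> hom (base P) (fobj (proj P) x) (fobj (proj P) (src_pull \<gamma>))"
    using u lift_proj[OF su \<psi>] c(3) by (simp add: fibre_def)
  then obtain \<chi> where "\<chi> \<in> lift u x (src_pull \<gamma>)" "src_cart \<gamma> \<bullet> \<chi> = \<psi>"
    using cartesian_factor[OF c(1,2) \<psi>] by blast
  then show thesis
    using that \<gamma> act_eq by blast
qed

lemma act_lift:
  assumes u: "u \<in> hom (base P) V D1" and \<psi>: "\<psi> \<in> lift (src \<odot> u) x \<gamma>"
  shows "act u \<psi> \<in> lift (tgt \<odot> u) x (Tob \<gamma>)"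
proof -
  obtain \<chi> where \<chi>: "\<gamma> \<in> Obj (fibre P D0)" "\<chi> \<in> lift u x (src_pull \<gamma>)" "act u \<psi> = tgt_cocart \<gamma> \<bullet> \<chi>"
    using act_factor[OF assms] .
  then show ?thesis
    using lift_Comp[OF \<chi>(2) tgt_cocart(2)[OF \<chi>(1)]] by simp
qed

lemma act_precomp:
  assumes u: "u \<in> hom (base P) V D1" and \<psi>: "\<psi> \<in> lift (src \<odot> u) x \<gamma>" and \<theta>: "\<theta> \<in> lift w z x"
  shows "act (u \<odot> w) (\<psi> \<bullet> \<theta>) = act u \<psi> \<bullet> \<theta>"
proof -
  obtain \<chi> where \<chi>: "\<gamma> \<in> Obj (fibre P D0)" "\<chi> \<in> lift u x (src_pull \<gamma>)" "\<psi> = src_cart \<gamma> \<bullet> \<chi>"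
    "act u \<psi> = tgt_cocart \<gamma> \<bullet> \<chi>"
    using act_factor[OF u \<psi>] .
  show ?thesis
    using act_eq[OF \<chi>(1) lift_Comp[OF \<theta> \<chi>(2)]] \<chi>(3,4)
      lift_assoc[OF \<theta> \<chi>(2) src_cart(2)[OF \<chi>(1)]] lift_assoc[OF \<theta> \<chi>(2) tgt_cocart(2)[OF \<chi>(1)]]
    by simp
qed

lemma vert_Obj: "\<phi> \<in> vert \<gamma> \<gamma>' \<Longrightarrow> \<gamma> \<in> Obj (fibre P D0)" "\<phi> \<in> vert \<gamma> \<gamma>' \<Longrightarrow> \<gamma>' \<in> Obj (fibre P D0)"
  using fibre_Obj_lift[OF D.ob0_Obj] by auto

lemma T_arr_lift:
  assumes "\<phi> \<in> vert \<gamma> \<gamma>'" shows "farr T \<phi> \<in> vert (Tob \<gamma>) (Tob \<gamma>')"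
  unfolding farr_T Tob_eq using push_arr(1)[OF D.itgt_hom pull_arr(1)[OF D.isrc_hom assms]] .

text \<open>This determines \<open>T\<close> on arrows by \<open>act\<close>, so that the functor laws and all
  naturality squares reduce to associativity in the total category.\<close>
lemma T_arr_act:
  assumes u: "u \<in> hom (base P) V D1" and \<psi>: "\<psi> \<in> lift (src \<odot> u) x \<gamma>" and \<phi>: "\<phi> \<in> vert \<gamma> \<gamma>'"
  shows "farr T \<phi> \<bullet> act u \<psi> = act u (\<phi> \<bullet> \<psi>)"
proof -
  obtain \<chi> where \<chi>: "\<gamma> \<in> Obj (fibre P D0)" "\<chi> \<in> lift u x (src_pull \<gamma>)" "\<psi> = src_cart \<gamma> \<bullet> \<chi>"
    "act u \<psi> = tgt_cocart \<gamma> \<bullet> \<chi>"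
    using act_factor[OF u \<psi>] .
  note \<gamma>' = vert_Obj(2)[OF \<phi>]
  note s\<phi> = pull_arr[OF D.isrc_hom \<phi>]
  have t\<phi>: "farr T \<phi> \<bullet> tgt_cocart \<gamma> = tgt_cocart \<gamma>' \<bullet> farr (pull P src) \<phi>"
    unfolding farr_T tgt_cocart_def using push_arr(2)[OF D.itgt_hom s\<phi>(1)] .
  note s\<chi> = vertical_lift_transport(1)[OF D.ob1_Obj s\<phi>(1) \<chi>(2)]
  have "farr T \<phi> \<bullet> act u \<psi> = tgt_cocart \<gamma>' \<bullet> farr (pull P src) \<phi> \<bullet> \<chi>"
    using \<chi>(4) t\<phi> lift_assoc[OF \<chi>(2) tgt_cocart(2)[OF \<chi>(1)] T_arr_lift[OF \<phi>]]
      lift_assoc[OF \<chi>(2) s\<phi>(1) tgt_cocart(2)[OF \<gamma>']] by simp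
  also have "\<dots> = act u (src_cart \<gamma>' \<bullet> farr (pull P src) \<phi> \<bullet> \<chi>)"
    using act_eq[OF \<gamma>' s\<chi>] by simp
  also have "\<dots> = act u (\<phi> \<bullet> \<psi>)"
    using s\<phi>(2) \<chi>(3) lift_assoc[OF \<chi>(2) s\<phi>(1) src_cart(2)[OF \<gamma>']]
      lift_assoc[OF \<chi>(2) src_cart(2)[OF \<chi>(1)] \<phi>] by simp
  finally show ?thesis .
qed

lemma src_Ide: "src \<odot> Ide (base P) D1 = src"
  using B.Comp_Ide_right D.isrc_hom by blast

lemma D1_Ide: "Ide (base P) D1 \<in> hom (base P) D1 D1"
  using B.Ide_hom D.ob1_Obj by blast

lemma src_cart_Ide: "\<gamma> \<in> Obj (fibre P D0) \<Longrightarrow> src_cart \<gamma> \<in> lift (src \<odot> Ide (base P) D1) (src_pull \<gamma>) \<gamma>"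
  using src_cart(2) by (simp add: src_Ide)

lemma tgt_cocart_act:
  assumes \<gamma>: "\<gamma> \<in> Obj (fibre P D0)"
  shows "tgt_cocart \<gamma> = act (Ide (base P) D1) (src_cart \<gamma>)"
proof -
  have "fobj (proj P) (src_pull \<gamma>) = D1" and "src_pull \<gamma> \<in> Obj (total P)"
    using src_cart(3)[OF \<gamma>] by (auto simp: fibre_def)
  then have "Ide (total P) (src_pull \<gamma>) \<in> lift (Ide (base P) D1) (src_pull \<gamma>) (src_pull \<gamma>)"
    using lift_Ide by metis
  then show ?thesis
    using act_eq[OF \<gamma>] lift_Ide_right[OF src_cart(2)[OF \<gamma>]] lift_Ide_right[OF tgt_cocart(2)[OF \<gamma>]]
    by metis
qed

text \<open>The arrow \<open>s\<^sup>* \<gamma> \<rightarrow> T \<gamma>\<close> is the value of \<open>act\<close> on the generic internal arrow, the identity of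
  \<open>D\<^sub>1\<close>. As it is cocartesian, equations between vertical arrows out of \<open>T \<gamma>\<close> can be tested on it.\<close>
lemma T_cancel:
  assumes "\<gamma> \<in> Obj (fibre P D0)" "\<chi> \<in> vert (Tob \<gamma>) z" "\<chi>' \<in> vert (Tob \<gamma>) z"
    and "\<chi> \<bullet> act (Ide (base P) D1) (src_cart \<gamma>) = \<chi>' \<bullet> act (Ide (base P) D1) (src_cart \<gamma>)"
  shows "\<chi> = \<chi>'"
  using cocartesian_cancel[OF tgt_cocart(1,2)[OF assms(1)] assms(2,3)] assms(4)
    tgt_cocart_act[OF assms(1)] by simp

lemma vert_Ide: "\<gamma> \<in> Obj (fibre P D0) \<Longrightarrow> Ide (total P) \<gamma> \<in> vert \<gamma> \<gamma>"
  using lift_Ide[of \<gamma>] by (auto simp: fibre_def)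

lemma vert_Comp: "\<phi> \<in> vert x y \<Longrightarrow> \<psi> \<in> vert y z \<Longrightarrow> \<psi> \<bullet> \<phi> \<in> vert x z"
  using vertical_lift_transport(1)[OF D.ob0_Obj] by blast

lemma T_Ide:
  assumes \<gamma>: "\<gamma> \<in> Obj (fibre P D0)" shows "farr T (Ide (total P) \<gamma>) = Ide (total P) (Tob \<gamma>)"
proof (rule T_cancel[OF \<gamma>])
  note c = src_cart_Ide[OF \<gamma>]
  show "farr T (Ide (total P) \<gamma>) \<in> vert (Tob \<gamma>) (Tob \<gamma>)"
    using T_arr_lift vert_Ide[OF \<gamma>] by blast
  show "Ide (total P) (Tob \<gamma>) \<in> vert (Tob \<gamma>) (Tob \<gamma>)"
    using vert_Ide tgt_cocart(3)[OF \<gamma>] by blast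
  show "farr T (Ide (total P) \<gamma>) \<bullet> act (Ide (base P) D1) (src_cart \<gamma>)
      = Ide (total P) (Tob \<gamma>) \<bullet> act (Ide (base P) D1) (src_cart \<gamma>)"
    using T_arr_act[OF D1_Ide c vert_Ide[OF \<gamma>]] lift_Ide_left[OF c]
      lift_Ide_left[OF act_lift[OF D1_Ide c]] by simp
qed

lemma T_Comp:
  assumes \<phi>: "\<phi> \<in> vert x y" and \<psi>: "\<psi> \<in> vert y z"
  shows "farr T (\<psi> \<bullet> \<phi>) = farr T \<psi> \<bullet> farr T \<phi>"
proof (rule T_cancel)
  show x: "x \<in> Obj (fibre P D0)"
    using vert_Obj \<phi> by blast
  note c = src_cart_Ide[OF x]
  note \<phi>c = vertical_lift_transport(1)[OF D.ob0_Obj \<phi> c]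
  show "farr T (\<psi> \<bullet> \<phi>) \<in> vert (Tob x) (Tob z)" "farr T \<psi> \<bullet> farr T \<phi> \<in> vert (Tob x) (Tob z)"
    using T_arr_lift vert_Comp \<phi> \<psi> by blast+
  show "farr T (\<psi> \<bullet> \<phi>) \<bullet> act (Ide (base P) D1) (src_cart x)
      = (farr T \<psi> \<bullet> farr T \<phi>) \<bullet> act (Ide (base P) D1) (src_cart x)"
    using T_arr_act[OF D1_Ide c vert_Comp[OF \<phi> \<psi>]] lift_assoc[OF c \<phi> \<psi>]
      T_arr_act[OF D1_Ide c \<phi>] T_arr_act[OF D1_Ide \<phi>c \<psi>]
      lift_assoc[OF act_lift[OF D1_Ide c] T_arr_lift[OF \<phi>] T_arr_lift[OF \<psi>]] by simp
qed

section \<open>Unit and multiplication\<close>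
definition eta where "eta \<gamma> = act idn (Ide (total P) \<gamma>)"

lemma vert_src_idn: "\<phi> \<in> vert x y \<Longrightarrow> \<phi> \<in> lift (src \<odot> idn) x y"
  by (simp add: D.isrc_iid)

lemma eta_lift: "\<gamma> \<in> Obj (fibre P D0) \<Longrightarrow> eta \<gamma> \<in> vert \<gamma> (Tob \<gamma>)"
  using act_lift[OF D.iid_hom vert_src_idn[OF vert_Ide]] by (simp add: eta_def D.itgt_iid)

lemma eta_Comp:
  assumes \<psi>: "\<psi> \<in> lift w x \<gamma>" and \<gamma>: "\<gamma> \<in> Obj (fibre P D0)"
  shows "eta \<gamma> \<bullet> \<psi> = act (idn \<odot> w) \<psi>"
  using act_precomp[OF D.iid_hom vert_src_idn[OF vert_Ide[OF \<gamma>]] \<psi>] lift_Ide_left[OF \<psi>]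
  by (simp add: eta_def)

lemma eta_natural:
  assumes \<phi>: "\<phi> \<in> vert x y" shows "eta y \<bullet> \<phi> = farr T \<phi> \<bullet> eta x"
proof -
  have x: "x \<in> Obj (fibre P D0)" and y: "y \<in> Obj (fibre P D0)"
    using vert_Obj \<phi> by auto
  have "idn \<odot> Ide (base P) D0 = idn"
    using B.Comp_Ide_right D.iid_hom by blast
  then show ?thesis
    using eta_Comp[OF \<phi> y] T_arr_act[OF D.iid_hom vert_src_idn[OF vert_Ide[OF x]] \<phi>]
      lift_Ide_right[OF \<phi>] by (simp add: eta_def)
qed

text \<open>The generic composable pair: \<open>pair_ob \<gamma>\<close> is \<open>pr2\<^sup>* s\<^sup>* \<gamma>\<close>, \<open>pair_cart \<gamma>\<close> is its cartesian arrow to \<open>\<gamma>\<close>,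
  and \<open>pair_cocart \<gamma> : pair_ob \<gamma> \<rightarrow> T T \<gamma>\<close> is the result of acting with both components in turn.\<close>
definition pair_ob where "pair_ob \<gamma> = fobj (pull P p2) (src_pull \<gamma>)"
definition pr2_cart where "pr2_cart \<gamma> = cart P p2 (src_pull \<gamma>)"
definition pair_cart where "pair_cart \<gamma> = src_cart \<gamma> \<bullet> pr2_cart \<gamma>"
definition pair_cocart where "pair_cocart \<gamma> = act p1 (act p2 (pair_cart \<gamma>))"

lemma pr2_cart:
  assumes \<gamma>: "\<gamma> \<in> Obj (fibre P D0)"
  shows "is_cartesian P (pr2_cart \<gamma>)" "pr2_cart \<gamma> \<in> lift p2 (pair_ob \<gamma>) (src_pull \<gamma>)"
    "pair_ob \<gamma> \<in> Obj (fibre P D2)"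
  using cart_pull[OF pr_hom(2) src_cart(3)[OF \<gamma>]] by (auto simp: pr2_cart_def pair_ob_def)

lemma pair_cart:
  assumes \<gamma>: "\<gamma> \<in> Obj (fibre P D0)"
  shows "is_cartesian P (pair_cart \<gamma>)" "pair_cart \<gamma> \<in> lift (src \<odot> p2) (pair_ob \<gamma>) \<gamma>"
  using cartesian_Comp[OF src_cart(1,2)[OF \<gamma>] pr2_cart(1,2)[OF \<gamma>]]
    lift_Comp[OF pr2_cart(2)[OF \<gamma>] src_cart(2)[OF \<gamma>]] by (auto simp: pair_cart_def)

text \<open>Beck--Chevalley at the square of composable pairs, transposed so that the base change is along \<open>s\<close>
  and the direct image along \<open>t\<close>. The square in the total category has sides \<open>s\<^sup>* \<gamma> \<rightarrow> T \<gamma>\<close>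
  over \<open>t\<close> and \<open>s\<^sup>* T \<gamma> \<rightarrow> T \<gamma>\<close> over \<open>s\<close>; its fourth side \<open>d\<close> exhibits \<open>s\<^sup>* T \<gamma>\<close> as the
  direct image of \<open>pair_ob \<gamma>\<close> along \<open>pr1\<close>.\<close>
lemma pr1_cocartesian:
  assumes \<gamma>: "\<gamma> \<in> Obj (fibre P D0)"
  obtains d where "is_cocartesian P d" "d \<in> lift p1 (pair_ob \<gamma>) (src_pull (Tob \<gamma>))"
    "src_cart (Tob \<gamma>) \<bullet> d = tgt_cocart \<gamma> \<bullet> pr2_cart \<gamma>" "pair_cocart \<gamma> = tgt_cocart (Tob \<gamma>) \<bullet> d"
proof -
  have a: "act p2 (pair_cart \<gamma>) = tgt_cocart \<gamma> \<bullet> pr2_cart \<gamma>"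
    unfolding pair_cart_def using act_eq[OF \<gamma> pr2_cart(2)[OF \<gamma>]] .
  have "act p2 (pair_cart \<gamma>) \<in> lift (src \<odot> p1) (pair_ob \<gamma>) (Tob \<gamma>)"
    using act_lift[OF pr_hom(2) pair_cart(2)[OF \<gamma>]] pr_hom(3) by simp
  then obtain d where d: "d \<in> lift p1 (pair_ob \<gamma>) (src_pull (Tob \<gamma>))"
    "act p2 (pair_cart \<gamma>) = src_cart (Tob \<gamma>) \<bullet> d" "pair_cocart \<gamma> = tgt_cocart (Tob \<gamma>) \<bullet> d"
    unfolding pair_cocart_def using act_factor[OF pr_hom(1)] by metis
  have "is_cocartesian P d"
    using beck_chevalley_cocartesian[OF beck_chevalley is_pullback_sym[OF D.pairs_pullback]
        tgt_cocart(1,2)[OF \<gamma>] src_cart(1,2)[OF tgt_cocart(3)[OF \<gamma>]] pr2_cart(1,2)[OF \<gamma>] d(1)] a d(2)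
    by simp
  then show thesis
    using that d a by simp
qed

lemma pair_cocart:
  assumes \<gamma>: "\<gamma> \<in> Obj (fibre P D0)"
  shows "is_cocartesian P (pair_cocart \<gamma>)" "pair_cocart \<gamma> \<in> lift (tgt \<odot> p1) (pair_ob \<gamma>) (Tob (Tob \<gamma>))"
proof -
  note c = tgt_cocart(1,2)[OF tgt_cocart(3)[OF \<gamma>]]
  obtain d where d: "is_cocartesian P d" "d \<in> lift p1 (pair_ob \<gamma>) (src_pull (Tob \<gamma>))"
    "pair_cocart \<gamma> = tgt_cocart (Tob \<gamma>) \<bullet> d"
    using pr1_cocartesian[OF \<gamma>] .
  show "is_cocartesian P (pair_cocart \<gamma>)"
    "pair_cocart \<gamma> \<in> lift (tgt \<odot> p1) (pair_ob \<gamma>) (Tob (Tob \<gamma>))"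
    using cocartesian_Comp[OF c d(1,2)] lift_Comp[OF d(2) c(2)] d(3) by simp_all
qed

lemma tgt_pr1_hom: "tgt \<odot> p1 \<in> hom (base P) D2 D0"
  using B.Comp_hom pr_hom(1) D.itgt_hom by blast

text \<open>Well defined because \<open>pair_cocart \<gamma>\<close> is cocartesian over \<open>t pr1\<close>, which equals \<open>t comp\<close>; so both
  arrows out of \<open>pair_ob \<gamma>\<close> lie over the same base arrow.\<close>
definition mu where
  "mu \<gamma> = (THE m. m \<in> vert (Tob (Tob \<gamma>)) (Tob \<gamma>) \<and> m \<bullet> pair_cocart \<gamma> = act cmp (pair_cart \<gamma>))"

lemma mu_arr:
  assumes \<gamma>: "\<gamma> \<in> Obj (fibre P D0)"
  shows "mu \<gamma> \<in> vert (Tob (Tob \<gamma>)) (Tob \<gamma>)" "mu \<gamma> \<bullet> pair_cocart \<gamma> = act cmp (pair_cart \<gamma>)"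
proof -
  have "act cmp (pair_cart \<gamma>) \<in> lift (tgt \<odot> p1) (pair_ob \<gamma>) (Tob \<gamma>)"
    using act_lift[OF D.icomp_hom] pair_cart(2)[OF \<gamma>] by (simp add: D.isrc_icomp D.itgt_icomp)
  from theI'[OF vertical_cocartesian_factor[OF tgt_pr1_hom pair_cocart[OF \<gamma>] this]]
  show "mu \<gamma> \<in> vert (Tob (Tob \<gamma>)) (Tob \<gamma>)" "mu \<gamma> \<bullet> pair_cocart \<gamma> = act cmp (pair_cart \<gamma>)"
    by (auto simp: mu_def)
qed

lemma act_act_lift:
  assumes w: "w \<in> hom (base P) V D2" and \<psi>: "\<psi> \<in> lift (src \<odot> p2 \<odot> w) x \<gamma>"
  shows "act (p2 \<odot> w) \<psi> \<in> lift (src \<odot> p1 \<odot> w) x (Tob \<gamma>)"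
    "act (p1 \<odot> w) (act (p2 \<odot> w) \<psi>) \<in> lift (tgt \<odot> p1 \<odot> w) x (Tob (Tob \<gamma>))"
proof -
  have "tgt \<odot> p2 \<odot> w = src \<odot> p1 \<odot> w"
    using B.Comp_assoc[OF w pr_hom(2) D.itgt_hom] B.Comp_assoc[OF w pr_hom(1) D.isrc_hom] pr_hom(3)
    by simp
  then show *: "act (p2 \<odot> w) \<psi> \<in> lift (src \<odot> p1 \<odot> w) x (Tob \<gamma>)"
    using act_lift[OF B.Comp_hom[OF w pr_hom(2)] \<psi>] by simp
  show "act (p1 \<odot> w) (act (p2 \<odot> w) \<psi>) \<in> lift (tgt \<odot> p1 \<odot> w) x (Tob (Tob \<gamma>))"
    using act_lift[OF B.Comp_hom[OF w pr_hom(1)] *] .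
qed

lemma pair_cocart_Comp:
  assumes \<gamma>: "\<gamma> \<in> Obj (fibre P D0)" and \<theta>: "\<theta> \<in> lift w z (pair_ob \<gamma>)"
  shows "pair_cocart \<gamma> \<bullet> \<theta> = act (p1 \<odot> w) (act (p2 \<odot> w) (pair_cart \<gamma> \<bullet> \<theta>))"
proof -
  note c = pair_cart(2)[OF \<gamma>]
  have "act p2 (pair_cart \<gamma>) \<in> lift (src \<odot> p1) (pair_ob \<gamma>) (Tob \<gamma>)"
    using act_lift[OF pr_hom(2) c] pr_hom(3) by simp
  then show ?thesis
    unfolding pair_cocart_def using act_precomp[OF pr_hom(2) c \<theta>] act_precomp[OF pr_hom(1) _ \<theta>] by simp
qed

text \<open>The composable pair is given by the single arrow \<open>w\<close> into the fibre product. The defining equation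
  of \<open>mu\<close> is the generic case, and an arbitrary \<open>\<psi>\<close> is obtained from it by precomposition,
  since \<open>pair_cart\<close> is cartesian.\<close>
lemma mu_act:
  assumes w: "w \<in> hom (base P) V D2" and \<psi>: "\<psi> \<in> lift (src \<odot> p2 \<odot> w) x \<gamma>"
  shows "mu \<gamma> \<bullet> act (p1 \<odot> w) (act (p2 \<odot> w) \<psi>) = act (cmp \<odot> w) \<psi>"
proof -
  have sp: "src \<odot> p2 \<in> hom (base P) D2 D0"
    using B.Comp_hom pr_hom(2) D.isrc_hom by blast
  have \<psi>': "\<psi> \<in> lift ((src \<odot> p2) \<odot> w) x \<gamma>"
    using \<psi> B.Comp_assoc[OF w pr_hom(2) D.isrc_hom] by simp
  note px = lift_proj[OF B.Comp_hom[OF w sp] \<psi>']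
  have \<gamma>: "\<gamma> \<in> Obj (fibre P D0)"
    using px lift_Obj[OF \<psi>] by (simp add: fibre_def)
  note c = pair_cart[OF \<gamma>]
  have "w \<in> hom (base P) (fobj (proj P) x) (fobj (proj P) (pair_ob \<gamma>))"
    using w px pr2_cart(3)[OF \<gamma>] by (simp add: fibre_def)
  then obtain \<chi> where \<chi>: "\<chi> \<in> lift w x (pair_ob \<gamma>)" "pair_cart \<gamma> \<bullet> \<chi> = \<psi>"
    using cartesian_factor[OF c \<psi>'] by blast
  have "mu \<gamma> \<bullet> act (p1 \<odot> w) (act (p2 \<odot> w) \<psi>) = mu \<gamma> \<bullet> pair_cocart \<gamma> \<bullet> \<chi>"
    using pair_cocart_Comp[OF \<gamma> \<chi>(1)] \<chi>(2) by simp
  also have "\<dots> = act cmp (pair_cart \<gamma>) \<bullet> \<chi>"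
    using lift_assoc[OF \<chi>(1) pair_cocart(2)[OF \<gamma>] mu_arr(1)[OF \<gamma>]] mu_arr(2)[OF \<gamma>] by simp
  also have "\<dots> = act (cmp \<odot> w) \<psi>"
    using act_precomp[OF D.icomp_hom c(2)[folded D.isrc_icomp] \<chi>(1)] \<chi>(2) by simp
  finally show ?thesis .
qed

lemma mu_natural:
  assumes \<phi>: "\<phi> \<in> vert x y" shows "mu y \<bullet> farr T (farr T \<phi>) = farr T \<phi> \<bullet> mu x"
proof -
  have x: "x \<in> Obj (fibre P D0)" and y: "y \<in> Obj (fibre P D0)"
    using vert_Obj \<phi> by auto
  have D2: "Ide (base P) D2 \<in> hom (base P) D2 D2"
    using B.Ide_hom B.Dom_Obj pr_hom(1) by (auto simp: hom_def)
  have w: "p1 \<odot> Ide (base P) D2 = p1" "p2 \<odot> Ide (base P) D2 = p2" "cmp \<odot> Ide (base P) D2 = cmp"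
    using B.Comp_Ide_right pr_hom D.icomp_hom by blast+
  note c = pair_cart(2)[OF x]
  note \<phi>c = vertical_lift_transport(1)[OF D.ob0_Obj \<phi> c]
  have ac: "act p2 (pair_cart x) \<in> lift (src \<odot> p1) (pair_ob x) (Tob x)"
    using act_act_lift(1)[OF D2, unfolded w, OF c] .
  have cc: "pair_cart x \<in> lift (src \<odot> cmp) (pair_ob x) x"
    using c D.isrc_icomp by simp
  have "(mu y \<bullet> farr T (farr T \<phi>)) \<bullet> pair_cocart x = mu y \<bullet> act p1 (act p2 (\<phi> \<bullet> pair_cart x))"
    using lift_assoc[OF pair_cocart(2)[OF x] T_arr_lift[OF T_arr_lift[OF \<phi>]] mu_arr(1)[OF y]]
      T_arr_act[OF pr_hom(1) ac T_arr_lift[OF \<phi>]] T_arr_act[OF pr_hom(2) c \<phi>]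
    by (simp add: pair_cocart_def)
  also have "\<dots> = act cmp (\<phi> \<bullet> pair_cart x)"
    using mu_act[OF D2, unfolded w, OF \<phi>c] .
  also have "\<dots> = (farr T \<phi> \<bullet> mu x) \<bullet> pair_cocart x"
    using T_arr_act[OF D.icomp_hom cc \<phi>] mu_arr(2)[OF x]
      lift_assoc[OF pair_cocart(2)[OF x] mu_arr(1)[OF x] T_arr_lift[OF \<phi>]] by simp
  finally show ?thesis
    by (rule cocartesian_cancel[OF pair_cocart[OF x]
          vert_Comp[OF T_arr_lift[OF T_arr_lift[OF \<phi>]] mu_arr(1)[OF y]]
          vert_Comp[OF mu_arr(1)[OF x] T_arr_lift[OF \<phi>]]])
qed

section \<open>The monad laws\<close>
lemma pairing:
  assumes "u \<in> hom (base P) V D1" "v \<in> hom (base P) V D1" "src \<odot> u = tgt \<odot> v"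
  obtains w where "w \<in> hom (base P) V D2" "p1 \<odot> w = u" "p2 \<odot> w = v"
proof -
  have "Dom (base P) src = D1" "Dom (base P) tgt = D1"
    using D.isrc_hom D.itgt_hom by (auto simp: hom_def)
  then show thesis
    using that D.pairs_pullback assms unfolding is_pullback_def by metis
qed

text \<open>Tested on the generic internal arrow \<open>f = id\<close>, the composite with \<open>\<eta> (T \<gamma>)\<close> acts first by \<open>f\<close> and
  then by the identity at the target of \<open>f\<close>; then \<open>mu\<close> composes the two.\<close>
lemma mu_unit_left:
  assumes \<gamma>: "\<gamma> \<in> Obj (fibre P D0)" shows "mu \<gamma> \<bullet> eta (Tob \<gamma>) = Ide (total P) (Tob \<gamma>)"
proof (rule T_cancel[OF \<gamma>])
  note T\<gamma> = tgt_cocart(3)[OF \<gamma>]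
  note c = src_cart_Ide[OF \<gamma>]
  show "Ide (total P) (Tob \<gamma>) \<in> vert (Tob \<gamma>) (Tob \<gamma>)" "mu \<gamma> \<bullet> eta (Tob \<gamma>) \<in> vert (Tob \<gamma>) (Tob \<gamma>)"
    using vert_Ide[OF T\<gamma>] vert_Comp[OF eta_lift[OF T\<gamma>] mu_arr(1)[OF \<gamma>]] by auto
  have it: "idn \<odot> tgt \<in> hom (base P) D1 D1"
    using B.Comp_hom D.itgt_hom D.iid_hom by blast
  have "src \<odot> idn \<odot> tgt = tgt \<odot> Ide (base P) D1"
    using B.Comp_assoc[OF D.itgt_hom D.iid_hom D.isrc_hom] B.Comp_Ide_left[OF D.itgt_hom]
      B.Comp_Ide_right[OF D.itgt_hom] D.isrc_iid by simp
  then obtain w where w: "w \<in> hom (base P) D1 D2" "p1 \<odot> w = idn \<odot> tgt" "p2 \<odot> w = Ide (base P) D1"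
    using pairing[OF it D1_Ide] by blast
  have a: "act (Ide (base P) D1) (src_cart \<gamma>) \<in> lift tgt (src_pull \<gamma>) (Tob \<gamma>)"
    using act_lift[OF D1_Ide c] B.Comp_Ide_right[OF D.itgt_hom] by simp
  have "(mu \<gamma> \<bullet> eta (Tob \<gamma>)) \<bullet> act (Ide (base P) D1) (src_cart \<gamma>)
      = mu \<gamma> \<bullet> act (p1 \<odot> w) (act (p2 \<odot> w) (src_cart \<gamma>))"
    using lift_assoc[OF a eta_lift[OF T\<gamma>] mu_arr(1)[OF \<gamma>]] eta_Comp[OF a T\<gamma>] w by simp
  also have "\<dots> = act (cmp \<odot> w) (src_cart \<gamma>)"
    using mu_act[OF w(1)] c w(3) by simp
  also have "\<dots> = Ide (total P) (Tob \<gamma>) \<bullet> act (Ide (base P) D1) (src_cart \<gamma>)"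
    using D.internal_unit_left[OF w] lift_Ide_left[OF a] by simp
  finally show "(mu \<gamma> \<bullet> eta (Tob \<gamma>)) \<bullet> act (Ide (base P) D1) (src_cart \<gamma>)
      = Ide (total P) (Tob \<gamma>) \<bullet> act (Ide (base P) D1) (src_cart \<gamma>)" .
qed

text \<open>As before, but with the identity at the source of \<open>f\<close>, on which \<open>f\<close> then acts.\<close>
lemma mu_unit_right:
  assumes \<gamma>: "\<gamma> \<in> Obj (fibre P D0)" shows "mu \<gamma> \<bullet> farr T (eta \<gamma>) = Ide (total P) (Tob \<gamma>)"
proof (rule T_cancel[OF \<gamma>])
  note T\<gamma> = tgt_cocart(3)[OF \<gamma>]
  note c = src_cart_Ide[OF \<gamma>]
  note T\<eta> = T_arr_lift[OF eta_lift[OF \<gamma>]]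
  show "Ide (total P) (Tob \<gamma>) \<in> vert (Tob \<gamma>) (Tob \<gamma>)" "mu \<gamma> \<bullet> farr T (eta \<gamma>) \<in> vert (Tob \<gamma>) (Tob \<gamma>)"
    using vert_Ide[OF T\<gamma>] vert_Comp[OF T\<eta> mu_arr(1)[OF \<gamma>]] by auto
  have i: "idn \<odot> src \<in> hom (base P) D1 D1"
    using B.Comp_hom D.isrc_hom D.iid_hom by blast
  have "src \<odot> Ide (base P) D1 = tgt \<odot> idn \<odot> src"
    using B.Comp_assoc[OF D.isrc_hom D.iid_hom D.itgt_hom] B.Comp_Ide_left[OF D.isrc_hom]
      B.Comp_Ide_right[OF D.isrc_hom] D.itgt_iid by simp
  then obtain w where w: "w \<in> hom (base P) D1 D2" "p1 \<odot> w = Ide (base P) D1" "p2 \<odot> w = idn \<odot> src"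
    using pairing[OF D1_Ide i] by blast
  have sis: "src \<odot> idn \<odot> src = src"
    using B.Comp_assoc[OF D.isrc_hom D.iid_hom D.isrc_hom] B.Comp_Ide_left[OF D.isrc_hom]
      D.isrc_iid by simp
  note a = act_lift[OF D1_Ide c]
  have "(mu \<gamma> \<bullet> farr T (eta \<gamma>)) \<bullet> act (Ide (base P) D1) (src_cart \<gamma>)
      = mu \<gamma> \<bullet> act (p1 \<odot> w) (act (p2 \<odot> w) (src_cart \<gamma>))"
    using lift_assoc[OF a T\<eta> mu_arr(1)[OF \<gamma>]] T_arr_act[OF D1_Ide c eta_lift[OF \<gamma>]]
      eta_Comp[OF src_cart(2)[OF \<gamma>] \<gamma>] w by simp
  also have "\<dots> = act (cmp \<odot> w) (src_cart \<gamma>)"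
    using mu_act[OF w(1)] src_cart(2)[OF \<gamma>] w(3) sis by simp
  also have "\<dots> = Ide (total P) (Tob \<gamma>) \<bullet> act (Ide (base P) D1) (src_cart \<gamma>)"
    using D.internal_unit_right[OF w] lift_Ide_left[OF a] by simp
  finally show "(mu \<gamma> \<bullet> farr T (eta \<gamma>)) \<bullet> act (Ide (base P) D1) (src_cart \<gamma>)
      = Ide (total P) (Tob \<gamma>) \<bullet> act (Ide (base P) D1) (src_cart \<gamma>)" .
qed

text \<open>The generic composable triple. Beck--Chevalley at the pullback defining the object of triples, applied
  to the arrow \<open>d\<close> of \<open>pr1_cocartesian\<close>, makes \<open>pair_ob (T \<gamma>)\<close> a direct image along \<open>q1\<close>;
  composing with \<open>pair_cocart (T \<gamma>)\<close> reaches \<open>T T T \<gamma>\<close>. The rest of the proof identifies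
  the composite with a threefold \<open>act\<close> along the components \<open>pr1 q1\<close>, \<open>pr1 q2 = pr2 q1\<close>
  and \<open>pr2 q2\<close> of the triple.\<close>
lemma triple_cocartesian:
  assumes \<gamma>: "\<gamma> \<in> Obj (fibre P D0)" and pb: "is_pullback (base P) q1 q2 p2 p1"
  obtains x \<psi> where "\<psi> \<in> lift (src \<odot> p2 \<odot> q2) x \<gamma>"
    "is_cocartesian P (act (p1 \<odot> q1) (act (p1 \<odot> q2) (act (p2 \<odot> q2) \<psi>)))"
proof -
  define D3 where "D3 = Dom (base P) q1"
  have q1: "q1 \<in> hom (base P) D3 D2" and q2: "q2 \<in> hom (base P) D3 D2" and eq: "p2 \<odot> q1 = p1 \<odot> q2"
    using pb pr_hom by (auto simp: is_pullback_def hom_def D3_def)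
  note T\<gamma> = tgt_cocart(3)[OF \<gamma>]
  obtain d where d: "is_cocartesian P d" "d \<in> lift p1 (pair_ob \<gamma>) (src_pull (Tob \<gamma>))"
    "src_cart (Tob \<gamma>) \<bullet> d = tgt_cocart \<gamma> \<bullet> pr2_cart \<gamma>" 
    using pr1_cocartesian[OF \<gamma>] .
  define e where "e = cart P q2 (pair_ob \<gamma>)"
  define x where "x = fobj (pull P q2) (pair_ob \<gamma>)"
  have e: "is_cartesian P e" "e \<in> lift q2 x (pair_ob \<gamma>)" and x: "x \<in> Obj (fibre P D3)"
    using cart_pull[OF q2 pr2_cart(3)[OF \<gamma>]] by (auto simp: e_def x_def)
  note b = pr2_cart[OF T\<gamma>]
  have "q1 \<in> hom (base P) (fobj (proj P) x) (fobj (proj P) (pair_ob (Tob \<gamma>)))"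
    using x b(3) q1 by (simp add: fibre_def)
  moreover have "d \<bullet> e \<in> lift (p2 \<odot> q1) x (src_pull (Tob \<gamma>))"
    using lift_Comp[OF e(2) d(2)] eq by simp
  ultimately obtain d' where d': "d' \<in> lift q1 x (pair_ob (Tob \<gamma>))" "pr2_cart (Tob \<gamma>) \<bullet> d' = d \<bullet> e"
    using cartesian_factor[OF b(1,2)] by blast
  have "is_cocartesian P d'"
    using beck_chevalley_cocartesian[OF beck_chevalley is_pullback_sym[OF pb] d(1,2) b(1,2) e d'] .
  then have co: "is_cocartesian P (pair_cocart (Tob \<gamma>) \<bullet> d')"
    using cocartesian_Comp[OF pair_cocart[OF T\<gamma>] _ d'(1)] by blast
  define \<psi> where "\<psi> = pair_cart \<gamma> \<bullet> e"
  have \<psi>: "\<psi> \<in> lift (src \<odot> p2 \<odot> q2) x \<gamma>"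
    using lift_Comp[OF e(2) pair_cart(2)[OF \<gamma>]] B.Comp_assoc[OF q2 pr_hom(2) D.isrc_hom]
    by (simp add: \<psi>_def)
  have "pair_cart (Tob \<gamma>) \<bullet> d' = src_cart (Tob \<gamma>) \<bullet> d \<bullet> e"
    unfolding pair_cart_def using lift_assoc[OF d'(1) b(2) src_cart(2)[OF T\<gamma>]] d'(2) by simp
  also have "\<dots> = (tgt_cocart \<gamma> \<bullet> pr2_cart \<gamma>) \<bullet> e"
    using lift_assoc[OF e(2) d(2) src_cart(2)[OF T\<gamma>]] d(3) by simp
  also have "\<dots> = act p2 (pair_cart \<gamma>) \<bullet> e"
    unfolding pair_cart_def using act_eq[OF \<gamma> pr2_cart(2)[OF \<gamma>]] by simp
  also have "\<dots> = act (p2 \<odot> q2) \<psi>"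
    using act_precomp[OF pr_hom(2) pair_cart(2)[OF \<gamma>] e(2)] by (simp add: \<psi>_def)
  finally have "pair_cocart (Tob \<gamma>) \<bullet> d' = act (p1 \<odot> q1) (act (p1 \<odot> q2) (act (p2 \<odot> q2) \<psi>))"
    using pair_cocart_Comp[OF T\<gamma> d'(1)] eq by simp
  then show thesis
    using that \<psi> co by simp
qed

text \<open>On the generic triple \<open>(h, g, f)\<close>, \<open>T (\<mu> \<gamma>)\<close> composes \<open>g\<close> with \<open>f\<close> whereas \<open>\<mu> (T \<gamma>)\<close> composes
  \<open>h\<close> with \<open>g\<close>; the second multiplication then yields the action of \<open>h (g f)\<close>, respectively
  \<open>(h g) f\<close>.\<close>
lemma mu_assoc:
  assumes \<gamma>: "\<gamma> \<in> Obj (fibre P D0)" shows "mu \<gamma> \<bullet> farr T (mu \<gamma>) = mu \<gamma> \<bullet> mu (Tob \<gamma>)"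
proof -
  note T\<gamma> = tgt_cocart(3)[OF \<gamma>]
  note T\<mu> = T_arr_lift[OF mu_arr(1)[OF \<gamma>]]
  obtain q1 q2 where pb: "is_pullback (base P) q1 q2 p2 p1"
    using pullback_exists[OF B.category_axioms finite_limits pr_hom(2,1)] by blast
  define D3 where "D3 = Dom (base P) q1"
  have q1: "q1 \<in> hom (base P) D3 D2" and q2: "q2 \<in> hom (base P) D3 D2" and eq: "p2 \<odot> q1 = p1 \<odot> q2"
    using pb pr_hom by (auto simp: is_pullback_def hom_def D3_def)
  note homs = B.Comp_hom[OF q1 D.icomp_hom] B.Comp_hom[OF q2 D.icomp_hom]
    B.Comp_hom[OF q1 pr_hom(1)] B.Comp_hom[OF q2 pr_hom(2)]
  have sc: "src \<odot> cmp \<odot> q = src \<odot> p2 \<odot> q" and tc: "tgt \<odot> cmp \<odot> q = tgt \<odot> p1 \<odot> q"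
    and st: "src \<odot> p1 \<odot> q = tgt \<odot> p2 \<odot> q"
    if "q \<in> hom (base P) D3 D2" for q
    using B.Comp_assoc[OF that D.icomp_hom D.isrc_hom] B.Comp_assoc[OF that D.icomp_hom D.itgt_hom]
      B.Comp_assoc[OF that pr_hom(1) D.isrc_hom] B.Comp_assoc[OF that pr_hom(1) D.itgt_hom]
      B.Comp_assoc[OF that pr_hom(2) D.isrc_hom] B.Comp_assoc[OF that pr_hom(2) D.itgt_hom]
      pr_hom(3) D.isrc_icomp D.itgt_icomp by simp_all
  \<comment> \<open>\<open>u = (h g, f)\<close> and \<open>v = (h, g f)\<close>.\<close>
  obtain u where u: "u \<in> hom (base P) D3 D2" "p1 \<odot> u = cmp \<odot> q1" "p2 \<odot> u = p2 \<odot> q2"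
  proof (rule pairing[OF homs(1,4)])
    show "src \<odot> cmp \<odot> q1 = tgt \<odot> p2 \<odot> q2"
      using sc[OF q1] eq st[OF q2] by simp
  qed
  obtain v where v: "v \<in> hom (base P) D3 D2" "p1 \<odot> v = p1 \<odot> q1" "p2 \<odot> v = cmp \<odot> q2"
  proof (rule pairing[OF homs(3,2)])
    show "src \<odot> p1 \<odot> q1 = tgt \<odot> cmp \<odot> q2"
      using tc[OF q2] eq st[OF q1] by simp
  qed
  have uv: "cmp \<odot> u = cmp \<odot> v"
    using D.internal_assoc[OF pb] u v D3_def by simp
  obtain x \<psi> where \<psi>: "\<psi> \<in> lift (src \<odot> p2 \<odot> q2) x \<gamma>"
    and co: "is_cocartesian P (act (p1 \<odot> q1) (act (p1 \<odot> q2) (act (p2 \<odot> q2) \<psi>)))"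
    using triple_cocartesian[OF \<gamma> pb] .
  define \<kappa> where "\<kappa> = act (p1 \<odot> q1) (act (p1 \<odot> q2) (act (p2 \<odot> q2) \<psi>))"
  have l1: "act (p2 \<odot> q2) \<psi> \<in> lift (src \<odot> p2 \<odot> q1) x (Tob \<gamma>)"
    using act_act_lift(1)[OF q2 \<psi>] eq by simp
  have l2: "act (p1 \<odot> q2) (act (p2 \<odot> q2) \<psi>) \<in> lift (src \<odot> p1 \<odot> q1) x (Tob (Tob \<gamma>))"
    using act_act_lift(1)[OF q1 l1] eq by simp
  have \<kappa>: "\<kappa> \<in> lift (tgt \<odot> p1 \<odot> q1) x (Tob (Tob (Tob \<gamma>)))"
    using act_lift[OF homs(3) l2] by (simp add: \<kappa>_def)
  have "(mu \<gamma> \<bullet> farr T (mu \<gamma>)) \<bullet> \<kappa> = mu \<gamma> \<bullet> act (p1 \<odot> v) (act (p2 \<odot> v) \<psi>)"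
    using lift_assoc[OF \<kappa> T\<mu> mu_arr(1)[OF \<gamma>]] T_arr_act[OF homs(3) l2 mu_arr(1)[OF \<gamma>]]
      mu_act[OF q2 \<psi>] v by (simp add: \<kappa>_def)
  also have "\<dots> = act (cmp \<odot> v) \<psi>"
    using mu_act[OF v(1)] \<psi> v(3) sc[OF q2] by simp
  also have "\<dots> = mu \<gamma> \<bullet> act (p1 \<odot> u) (act (p2 \<odot> u) \<psi>)"
    using mu_act[OF u(1)] \<psi> u(3) uv by simp
  also have "\<dots> = (mu \<gamma> \<bullet> mu (Tob \<gamma>)) \<bullet> \<kappa>"
    using lift_assoc[OF \<kappa> mu_arr(1)[OF T\<gamma>] mu_arr(1)[OF \<gamma>]] mu_act[OF q1 l1] u eq
    by (simp add: \<kappa>_def)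
  finally show ?thesis
    by (rule cocartesian_cancel[OF co[folded \<kappa>_def] \<kappa> vert_Comp[OF T\<mu> mu_arr(1)[OF \<gamma>]]
          vert_Comp[OF mu_arr(1)[OF T\<gamma>] mu_arr(1)[OF \<gamma>]]])
qed

lemma fibre_monad: "monad (fibre P D0) T eta mu"
proof -
  interpret F: category "fibre P D0"
    by (rule fibre_category[OF D.ob0_Obj])
  have sel: "Comp (fibre P D0) = Comp (total P)" "Ide (fibre P D0) = Ide (total P)"
    by (auto simp: fibre_def)
  interpret I: is_functor "fibre P D0" "fibre P D0" id_fctr
    by unfold_locales (auto simp: id_fctr_def)
  interpret T: is_functor "fibre P D0" "fibre P D0" T
    by unfold_locales
      (use tgt_cocart(3) T_arr_lift T_Ide T_Comp in \<open>auto simp: hom_fibre sel\<close>)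
  interpret TT: is_functor "fibre P D0" "fibre P D0" "T \<circ>\<^sub>F T"
    by unfold_locales
      (auto simp: comp_fctr_def T.fobj_Obj T.farr_hom T.farr_Ide T.farr_Comp
        T.farr_Comp[OF T.farr_hom T.farr_hom])
  interpret eta: natural_transformation "fibre P D0" "fibre P D0" id_fctr T eta
    by unfold_locales (use eta_lift eta_natural in \<open>auto simp: id_fctr_def hom_fibre sel\<close>)
  interpret mu: natural_transformation "fibre P D0" "fibre P D0" "T \<circ>\<^sub>F T" T mu
    by unfold_locales (use mu_arr(1) mu_natural in \<open>auto simp: comp_fctr_def hom_fibre sel\<close>)
  show ?thesis
    by unfold_locales (use mu_assoc mu_unit_left mu_unit_right in \<open>auto simp: sel\<close>)
qed

end

theorem theorem6p8:
  fixes P :: "('o, 'a, 'p, 'b) bifib" and D :: "('o, 'a) internal_cat"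
  assumes "has_finite_limits (base P)"
    and "normal_bifibration P"
    and "beck_chevalley P"
    and "internal_category (base P) D"
  shows "\<exists>\<eta> \<mu>. monad (fibre P (ob0 D)) (internal_fctr P D) \<eta> \<mu>"
proof -
  interpret internal_category_in_bifibration P D
    using assms unfolding internal_category_in_bifibration_def
      internal_category_in_bifibration_axioms_def normal_bifibration_def by auto
  show ?thesis
    using fibre_monad by blast
qed

end
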